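(* There is a polynomial-time algorithm that, given an interval graph $G$ and two independent sets $I$ and $J$ of $G$ of size $k$, decides whether $I$ and $J$ lie in the same connected component of the $k$-TS reconfiguration graph $TS_k(G)$.
   Context: An interval graph is the intersection graph of a family of intervals of the real line. The $k$-TS reconfiguration graph $TS_k(G)$ has as vertices the independent sets of $G$ of size exactly $k$, and two such sets $I,J$ are adjacent if $I\setminus J=\{v\}$, $J\setminus I=\{u\}$ and $uv$ is an edge of $G$. *)

theory Defs
  imports
    "HOL-Analysis.Analysis"
    "HOL-Computational_Algebra.Polynomial"
    "Graph_Theory.Graph_Theory"
begin

section \<open>Interval graphs and token sliding\<close>

text \<open>A finite simple graph is a \<^const>\<open>pair_graph\<close>: a finite, loop-free digraph in which the
  edge \<open>uv\<close> is represented by the two arcs \<open>(u, v)\<close> and \<open>(v, u)\<close>.\<close>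

definition interval_graph :: "'a pair_pre_digraph \<Rightarrow> bool" where
  "interval_graph G \<longleftrightarrow> pair_graph G \<and>
     (\<exists>S :: 'a \<Rightarrow> real set.
        (\<forall>v \<in> pverts G. is_interval (S v) \<and> S v \<noteq> {}) \<and>
        (\<forall>u \<in> pverts G. \<forall>v \<in> pverts G. u \<noteq> v \<longrightarrow>
           ((u, v) \<in> parcs G \<longleftrightarrow> S u \<inter> S v \<noteq> {})))"

definition independent_sets :: "'a pair_pre_digraph \<Rightarrow> nat \<Rightarrow> 'a set set" where
  "independent_sets G k =
     {I. I \<subseteq> pverts G \<and> card I = k \<and> (\<forall>u \<in> I. \<forall>v \<in> I. (u, v) \<notin> parcs G)}"

definition TS :: "nat \<Rightarrow> 'a pair_pre_digraph \<Rightarrow> 'a set pair_pre_digraph" where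
  "TS k G = \<lparr> pverts = independent_sets G k,
              parcs = {(I, J). I \<in> independent_sets G k \<and> J \<in> independent_sets G k \<and>
                         (\<exists>u v. I - J = {v} \<and> J - I = {u} \<and> (u, v) \<in> parcs G)} \<rparr>"

lemma pair_graph_TS:
  assumes "pair_graph G"
  shows "pair_graph (TS k G)"
proof -
  interpret pair_graph G by fact
  have s: "(u, v) \<in> parcs G \<Longrightarrow> (v, u) \<in> parcs G" for u v
    using pair_sym_arcs by (auto simp: symmetric_def sym_def)
  have fin: "finite (independent_sets G k)"
    by (rule finite_subset[of _ "Pow (pverts G)"]) (auto simp: independent_sets_def)
  have arcs: "parcs (TS k G) \<subseteq> independent_sets G k \<times> independent_sets G k"
    by (auto simp: TS_def)
  show ?thesis
  proof
    show "finite (parcs (TS k G))"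
      using arcs fin by (meson finite_SigmaI finite_subset)
    show "symmetric (with_proj (TS k G))"
      unfolding symmetric_def with_proj_simps
    proof (rule symI)
      fix I J assume "(I, J) \<in> parcs (TS k G)"
      then obtain u v where "I \<in> independent_sets G k" "J \<in> independent_sets G k"
        "I - J = {v}" "J - I = {u}" "(u, v) \<in> parcs G"
        unfolding TS_def by auto
      with s[of u v] show "(J, I) \<in> parcs (TS k G)"
        unfolding TS_def by simp
    qed
    fix e assume e: "e \<in> parcs (TS k G)"
    show "fst e \<in> pverts (TS k G)" "snd e \<in> pverts (TS k G)"
      using e arcs by (auto simp: TS_def)
    obtain v where "fst e - snd e = {v}"
      using e unfolding TS_def by auto
    then show "fst e \<noteq> snd e"
      by (metis Diff_cancel insert_not_empty)
  qed (simp add: TS_def fin)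
qed

text \<open>The graph \<open>TS k G\<close> is symmetric, so its strongly connected components are its connected
  components.\<close>

definition same_component :: "'a pair_pre_digraph \<Rightarrow> 'a \<Rightarrow> 'a \<Rightarrow> bool" where
  "same_component H x y \<longleftrightarrow>
     (\<exists>C \<in> pre_digraph.sccs_verts (with_proj H). x \<in> C \<and> y \<in> C)"

section \<open>Machine model\<close>

text \<open>Algorithms are programs of a first-order, call-by-value functional language over LISP
  data, with one time unit per evaluated construct. There are no primitives besides
  constructing, destructing and branching on pairs. A value can be represented by
  a pointer into a heap of shared cells, a step allocates at most one cell, and the length of an
  environment is bounded by a constant of the program; hence \<open>t\<close> steps can be simulated by a
  Turing machine in time polynomial in \<open>t\<close> and the input size, and conversely the language
  simulates a Turing machine with constant overhead per step.\<close>

datatype sexp = SNil | SCons sexp sexp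

datatype expr =
    Var nat
  | MkNil
  | MkCons expr expr
  | Hd expr
  | Tl expr
  | Cond expr expr expr
  | Call nat "expr list"

text \<open>A program is the list of the bodies of its functions. \<open>Call f es\<close> refers to the \<open>f\<close>-th body,
  and \<open>Var i\<close> inside a body to the \<open>i\<close>-th actual parameter.\<close>

type_synonym program = "expr list"

primrec shd :: "sexp \<Rightarrow> sexp" where
  "shd SNil = SNil"
| "shd (SCons a b) = a"

primrec stl :: "sexp \<Rightarrow> sexp" where
  "stl SNil = SNil"
| "stl (SCons a b) = b"

text \<open>\<open>eval P env e v t\<close>: in environment \<open>env\<close>, the expression \<open>e\<close> evaluates to \<open>v\<close> in \<open>t\<close> steps.
  Divergence and errors (unbound variables or functions) amount to the absence of a derivation.\<close>

inductive eval :: "program \<Rightarrow> sexp list \<Rightarrow> expr \<Rightarrow> sexp \<Rightarrow> nat \<Rightarrow> bool"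
  and evals :: "program \<Rightarrow> sexp list \<Rightarrow> expr list \<Rightarrow> sexp list \<Rightarrow> nat \<Rightarrow> bool"
  for P :: program where
  eval_Var: "i < length env \<Longrightarrow> eval P env (Var i) (env ! i) 1"
| eval_Nil: "eval P env MkNil SNil 1"
| eval_Cons: "eval P env e1 v1 t1 \<Longrightarrow> eval P env e2 v2 t2 \<Longrightarrow>
    eval P env (MkCons e1 e2) (SCons v1 v2) (t1 + t2 + 1)"
| eval_Hd: "eval P env e v t \<Longrightarrow> eval P env (Hd e) (shd v) (t + 1)"
| eval_Tl: "eval P env e v t \<Longrightarrow> eval P env (Tl e) (stl v) (t + 1)"
| eval_Cond_then: "eval P env e v t \<Longrightarrow> v \<noteq> SNil \<Longrightarrow> eval P env e1 v1 t1 \<Longrightarrow>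
    eval P env (Cond e e1 e2) v1 (t + t1 + 1)"
| eval_Cond_else: "eval P env e SNil t \<Longrightarrow> eval P env e2 v2 t2 \<Longrightarrow>
    eval P env (Cond e e1 e2) v2 (t + t2 + 1)"
| eval_Call: "evals P env es vs t1 \<Longrightarrow> f < length P \<Longrightarrow> eval P vs (P ! f) v t2 \<Longrightarrow>
    eval P env (Call f es) v (t1 + t2 + 1)"
| evals_Nil: "evals P env [] [] 0"
| evals_Cons: "eval P env e v t1 \<Longrightarrow> evals P env es vs t2 \<Longrightarrow>
    evals P env (e # es) (v # vs) (t1 + t2)"

inductive_cases eval_elims:
  "eval P env (Var i) v t"
  "eval P env MkNil v t"
  "eval P env (MkCons e1 e2) v t"
  "eval P env (Hd e) v t"
  "eval P env (Tl e) v t"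
  "eval P env (Cond e e1 e2) v t"
  "eval P env (Call f es) v t"
  "evals P env [] vs t"
  "evals P env (e # es) vs t"

lemma eval_deterministic:
  "eval P env e v t \<Longrightarrow> eval P env e v' t' \<Longrightarrow> v' = v \<and> t' = t"
  "evals P env es vs t \<Longrightarrow> evals P env es vs' t' \<Longrightarrow> vs' = vs \<and> t' = t"
proof (induction arbitrary: v' t' and vs' t' rule: eval_evals.inducts)
  case (eval_Var i env)
  from eval_Var.prems show ?case
    by (rule eval_elims) simp
next
  case (eval_Nil env)
  from eval_Nil.prems show ?case
    by (rule eval_elims) simp
next
  case (eval_Cons env e1 v1 t1 e2 v2 t2)
  from eval_Cons.prems show ?case
    by (rule eval_elims) (auto dest: eval_Cons.IH(2,4))
next
  case (eval_Hd env e v t)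
  from eval_Hd.prems show ?case
    by (rule eval_elims) (auto dest: eval_Hd.IH(2))
next
  case (eval_Tl env e v t)
  from eval_Tl.prems show ?case
    by (rule eval_elims) (auto dest: eval_Tl.IH(2))
next
  case (eval_Cond_then env e v t e1 v1 t1 e2)
  from eval_Cond_then.prems show ?case
    by (rule eval_elims) (auto dest: eval_Cond_then.IH(2,4) simp: eval_Cond_then.hyps)
next
  case (eval_Cond_else env e t e2 v2 t2 e1)
  from eval_Cond_else.prems show ?case
    by (rule eval_elims) (auto dest: eval_Cond_else.IH(2,4))
next
  case (eval_Call env es vs t1 f v t2)
  from eval_Call.prems show ?case
    by (rule eval_elims) (auto dest: eval_Call.IH(2,5))
next
  case (evals_Nil env)
  from evals_Nil.prems show ?case
    by (rule eval_elims) simp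
next
  case (evals_Cons env e v t1 es vs t2)
  from evals_Cons.prems show ?case
    by (rule eval_elims) (auto dest: evals_Cons.IH(2,4))
qed

definition runs :: "program \<Rightarrow> sexp \<Rightarrow> sexp \<Rightarrow> nat \<Rightarrow> bool" where
  "runs P x v t \<longleftrightarrow> eval P [x] (Call 0 [Var 0]) v t"

text \<open>As for any truth value of the language, the answer \<open>SNil\<close> means no and every other answer
  means yes. The input size \<open>size (enc x)\<close> is the number of pairs of the encoding. The
  set \<open>D\<close> is the promise: nothing is required of the program on inputs outside of it.\<close>

definition decides_in_poly_time ::
  "program \<Rightarrow> ('i \<Rightarrow> sexp) \<Rightarrow> 'i set \<Rightarrow> ('i \<Rightarrow> bool) \<Rightarrow> bool" where
  "decides_in_poly_time P enc D Q \<longleftrightarrow>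
     (\<exists>p :: nat poly. \<forall>x \<in> D. \<exists>v t.
        runs P (enc x) v t \<and> t \<le> poly p (size (enc x)) \<and> (v \<noteq> SNil \<longleftrightarrow> Q x))"

section \<open>Encoding of the instances\<close>

text \<open>As usual, the vertices of an input graph are \<open>0, \<dots>, n - 1\<close>. The graph is given by its
  adjacency matrix and the two vertex sets by their characteristic vectors.\<close>

definition encode_list :: "sexp list \<Rightarrow> sexp" where
  "encode_list xs = foldr SCons xs SNil"

definition encode_bool :: "bool \<Rightarrow> sexp" where
  "encode_bool b = (if b then SCons SNil SNil else SNil)"

definition encode_set :: "nat \<Rightarrow> nat set \<Rightarrow> sexp" where
  "encode_set n A = encode_list (map (\<lambda>v. encode_bool (v \<in> A)) [0..<n])"

definition encode_graph :: "nat pair_pre_digraph \<Rightarrow> sexp" where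
  "encode_graph G = (let n = card (pverts G) in
     encode_list (map (\<lambda>u. encode_set n {v. (u, v) \<in> parcs G}) [0..<n]))"

type_synonym ts_instance = "nat pair_pre_digraph \<times> nat \<times> nat set \<times> nat set"

text \<open>The number \<open>k\<close> is not written down, since it is the number of ones of either vector.\<close>

fun encode_instance :: "ts_instance \<Rightarrow> sexp" where
  "encode_instance (G, k, I, J) =
     encode_list [encode_graph G,
       encode_set (card (pverts G)) I, encode_set (card (pverts G)) J]"

end

theory Submission
  imports Defs
begin

text \<open>Disjoint intervals are ordered from left to right, and sliding preserves the order of the tokens.
  Let \<open>R r\<close> be the set of the positions that the \<open>r\<close>-th token can reach. Parking a token at the position
  of \<open>R r\<close> whose right end is leftmost never obstructs the higher tokens, and dually. Hence all
  tokens can be parked leftmost at once, so the component is determined by the family \<open>R\<close>, and \<open>R\<close> is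
  the least family such that \<open>w \<in> R r\<close> whenever \<open>w\<close> is adjacent to some \<open>u \<in> R r\<close>, every \<open>R l\<close> with
  \<open>l < r\<close> has an element to the left of \<open>w\<close>, and every \<open>R l\<close> with \<open>l > r\<close> has one to the right.

  The algorithm need not know the left-to-right order: it saturates a table of
  pairs of token positions, in which a token only moves to a vertex non-adjacent to the other one, so
  that the order of the pair is inherited from the start. Two independent sets are
  in the same component iff the families \<open>R\<close> read off from their tables agree.\<close>

text \<open>Why pairs, and why nothing larger: adjacency tells that two vertices are comparable, but
  not which one is on the left. Knowing the reachable positions of each token separately, one
  therefore cannot tell whether two non-adjacent positions are in the right order. A pair remembers
  it, because a vertex apart from both ends of an edge lies on the same side of both ends. On the
  other hand, parking makes the demands of different tokens independent of each other: for a move,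
  every other token needs some suitable position of its own, and these positions need not come from
  one configuration. Hence at most \<open>n ^ 4\<close> facts have to be recorded, although the
  number of configurations may be exponential.\<close>

section \<open>Token sliding in interval orders\<close>

text \<open>These are the axioms of an interval order: \<open>prec_cross\<close> excludes two chains
  of two elements with no comparability between them (no induced 2 + 2). Arguing from the axioms
  avoids endpoints, which an interval need not contain or even have.\<close>

locale interval_order =
  fixes V :: "'a set" and prec :: "'a \<Rightarrow> 'a \<Rightarrow> bool" (infix "\<sqsubset>" 50)
  assumes finite_V: "finite V"
    and prec_V: "x \<sqsubset> y \<Longrightarrow> x \<in> V \<and> y \<in> V"
    and prec_irrefl: "\<not> x \<sqsubset> x"
    and prec_trans: "x \<sqsubset> y \<Longrightarrow> y \<sqsubset> z \<Longrightarrow> x \<sqsubset> z"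
    and prec_cross: "a \<sqsubset> b \<Longrightarrow> c \<sqsubset> d \<Longrightarrow> a \<sqsubset> d \<or> c \<sqsubset> b"
begin

definition overlap :: "'a \<Rightarrow> 'a \<Rightarrow> bool" where
  "overlap x y \<longleftrightarrow> x \<in> V \<and> y \<in> V \<and> x \<noteq> y \<and> \<not> x \<sqsubset> y \<and> \<not> y \<sqsubset> x"

definition valid :: "nat \<Rightarrow> (nat \<Rightarrow> 'a) \<Rightarrow> bool" where
  "valid k c \<longleftrightarrow> (\<forall>r<k. c r \<in> V) \<and> (\<forall>s<k. \<forall>r<s. c r \<sqsubset> c s)"

definition slide :: "nat \<Rightarrow> (nat \<Rightarrow> 'a) \<Rightarrow> (nat \<Rightarrow> 'a) \<Rightarrow> bool" where
  "slide k c d \<longleftrightarrow> valid k c \<and> valid k d \<and> (\<exists>r<k. \<exists>w. overlap (c r) w \<and> d = c(r := w))"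

abbreviation reach :: "nat \<Rightarrow> (nat \<Rightarrow> 'a) \<Rightarrow> (nat \<Rightarrow> 'a) \<Rightarrow> bool" where
  "reach k \<equiv> (slide k)\<^sup>*\<^sup>*"

definition positions :: "nat \<Rightarrow> (nat \<Rightarrow> 'a) \<Rightarrow> nat \<Rightarrow> 'a set" where
  "positions k c r = {d r | d. reach k c d}"

definition lowest :: "'a set \<Rightarrow> 'a" where
  "lowest X = (SOME x. x \<in> X \<and> (\<forall>y\<in>X. \<forall>z. y \<sqsubset> z \<longrightarrow> x \<sqsubset> z))"

definition highest :: "'a set \<Rightarrow> 'a" where
  "highest X = (SOME x. x \<in> X \<and> (\<forall>y\<in>X. \<forall>z. z \<sqsubset> y \<longrightarrow> z \<sqsubset> x))"

text \<open>By \<open>prec_cross\<close> the sets of elements to the right of a given element form a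
  chain under inclusion, so some member of \<open>X\<close> has the largest such set. It stands for
  the interval whose right end is leftmost.\<close>

lemma ex_lowest:
  assumes "finite X" "X \<noteq> {}"
  shows "\<exists>x\<in>X. \<forall>y\<in>X. \<forall>z. y \<sqsubset> z \<longrightarrow> x \<sqsubset> z"
  using assms
proof (induction rule: finite_ne_induct)
  case (insert a F)
  then obtain x where "x \<in> F" "\<forall>y\<in>F. \<forall>z. y \<sqsubset> z \<longrightarrow> x \<sqsubset> z" by auto
  moreover have "(\<forall>z. x \<sqsubset> z \<longrightarrow> a \<sqsubset> z) \<or> (\<forall>z. a \<sqsubset> z \<longrightarrow> x \<sqsubset> z)"
    using prec_cross by blast
  ultimately show ?case by blast
qed auto

lemma ex_highest:
  assumes "finite X" "X \<noteq> {}"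
  shows "\<exists>x\<in>X. \<forall>y\<in>X. \<forall>z. z \<sqsubset> y \<longrightarrow> z \<sqsubset> x"
  using assms
proof (induction rule: finite_ne_induct)
  case (insert a F)
  then obtain x where "x \<in> F" "\<forall>y\<in>F. \<forall>z. z \<sqsubset> y \<longrightarrow> z \<sqsubset> x" by auto
  moreover have "(\<forall>z. z \<sqsubset> x \<longrightarrow> z \<sqsubset> a) \<or> (\<forall>z. z \<sqsubset> a \<longrightarrow> z \<sqsubset> x)"
    using prec_cross by blast
  ultimately show ?case by blast
qed auto

lemma lowest:
  assumes "finite X" "X \<noteq> {}"
  shows "lowest X \<in> X" "y \<in> X \<Longrightarrow> y \<sqsubset> z \<Longrightarrow> lowest X \<sqsubset> z"
proof -
  have "lowest X \<in> X \<and> (\<forall>y\<in>X. \<forall>z. y \<sqsubset> z \<longrightarrow> lowest X \<sqsubset> z)"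
    unfolding lowest_def by (rule someI_ex) (use ex_lowest[OF assms] in blast)
  then show "lowest X \<in> X" "y \<in> X \<Longrightarrow> y \<sqsubset> z \<Longrightarrow> lowest X \<sqsubset> z" by blast+
qed

lemma highest:
  assumes "finite X" "X \<noteq> {}"
  shows "highest X \<in> X" "y \<in> X \<Longrightarrow> z \<sqsubset> y \<Longrightarrow> z \<sqsubset> highest X"
proof -
  have "highest X \<in> X \<and> (\<forall>y\<in>X. \<forall>z. z \<sqsubset> y \<longrightarrow> z \<sqsubset> highest X)"
    unfolding highest_def by (rule someI_ex) (use ex_highest[OF assms] in blast)
  then show "highest X \<in> X" "y \<in> X \<Longrightarrow> z \<sqsubset> y \<Longrightarrow> z \<sqsubset> highest X" by blast+
qed

lemma valid_prec: "valid k c \<Longrightarrow> r < s \<Longrightarrow> s < k \<Longrightarrow> c r \<sqsubset> c s"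
  by (simp add: valid_def)

lemma valid_inj_on: "valid k c \<Longrightarrow> inj_on c {..<k}"
  unfolding inj_on_def by (metis lessThan_iff linorder_neqE_nat prec_irrefl valid_prec)

lemma overlap_sym: "overlap x y \<Longrightarrow> overlap y x"
  by (auto simp: overlap_def)

text \<open>Otherwise \<open>w \<sqsubset> x \<sqsubset> u\<close>, against the overlap of
  \<open>u\<close> and \<open>w\<close>. This is how order passes along an edge while only adjacency
  is tested.\<close>

lemma overlap_prec_left:
  assumes "x \<sqsubset> u" "overlap u w" "x \<noteq> w" "\<not> overlap x w"
  shows "x \<sqsubset> w"
  using assms prec_V prec_trans unfolding overlap_def by blast

lemma overlap_prec_right:
  assumes "u \<sqsubset> x" "overlap u w" "x \<noteq> w" "\<not> overlap x w"
  shows "w \<sqsubset> x"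
  using assms prec_V prec_trans unfolding overlap_def by blast

lemma slide_sym: "slide k c d \<Longrightarrow> slide k d c"
  unfolding slide_def by (metis fun_upd_same fun_upd_triv fun_upd_upd overlap_sym)

lemma reach_sym: "reach k c d \<Longrightarrow> reach k d c"
  by (metis slide_sym sympI symp_rtranclp sympD)

lemma reach_valid: "reach k c d \<Longrightarrow> valid k c \<Longrightarrow> valid k d"
  by (induction rule: rtranclp_induct) (auto simp: slide_def)

lemma positions_eq: "reach k c d \<Longrightarrow> positions k c r = positions k d r"
  unfolding positions_def by (metis reach_sym rtranclp_trans)

lemma positions_ne: "positions k c r \<noteq> {}"
  unfolding positions_def by blast

lemma finite_positions: "valid k c \<Longrightarrow> r < k \<Longrightarrow> finite (positions k c r)"
  by (rule finite_subset[OF _ finite_V]) (auto simp: positions_def valid_def dest!: reach_valid)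

lemmas lowest_position = lowest[OF finite_positions positions_ne]
lemmas highest_position = highest[OF finite_positions positions_ne]

section \<open>Parking tokens at extreme positions\<close>

definition pin :: "nat set \<Rightarrow> (nat \<Rightarrow> 'a) \<Rightarrow> (nat \<Rightarrow> 'a) \<Rightarrow> nat \<Rightarrow> 'a" where
  "pin A f c r = (if r \<in> A then f r else c r)"

text \<open>Parking the tokens of \<open>A\<close> at the positions given by \<open>f\<close> never obstructs the other tokens.\<close>

definition pinnable :: "nat \<Rightarrow> (nat \<Rightarrow> 'a) \<Rightarrow> nat set \<Rightarrow> (nat \<Rightarrow> 'a) \<Rightarrow> bool" where
  "pinnable k c0 A f \<longleftrightarrow> (\<forall>c. reach k c0 c \<longrightarrow> reach k c0 (pin A f c))"

text \<open>Take a reachable \<open>d\<close> with token \<open>i\<close> at \<open>f i\<close> and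
  replay the slides from \<open>d\<close> to \<open>c\<close>, leaving out those of the pinned
  tokens. By \<open>lo\<close> and \<open>hi\<close> the free tokens never get in the way of
  \<open>f i\<close>; the tokens of \<open>A\<close> are in order with it because they are so in
  \<open>pin A f d\<close>.\<close>

lemma pinnable_insert:
  assumes c0: "valid k c0" and A: "pinnable k c0 A f" and i: "i \<notin> A" "f i \<in> positions k c0 i"
    and lo: "\<And>c l. reach k c0 c \<Longrightarrow> l \<notin> A \<Longrightarrow> l < i \<Longrightarrow> i < k \<Longrightarrow> c l \<sqsubset> f i"
    and hi: "\<And>c l. reach k c0 c \<Longrightarrow> l \<notin> A \<Longrightarrow> i < l \<Longrightarrow> l < k \<Longrightarrow> f i \<sqsubset> c l"
  shows "pinnable k c0 (insert i A) f"
  unfolding pinnable_def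
proof (intro allI impI)
  fix c assume c: "reach k c0 c"
  obtain d where d: "reach k c0 d" "d i = f i"
    using i(2) by (auto simp: positions_def)
  have v: "valid k (pin (insert i A) f e)" if e: "reach k c0 e" for e
  proof -
    have 1: "valid k (pin A f d)" "valid k (pin A f e)"
      using A d(1) e reach_valid[OF _ c0] by (auto simp: pinnable_def)
    have "pin (insert i A) f e r \<sqsubset> pin (insert i A) f e s" if rs: "r < s" "s < k" for r s
    proof -
      have "pin A f d r \<sqsubset> pin A f d s" "pin A f e r \<sqsubset> pin A f e s"
        using 1 rs by (auto simp: valid_def)
      then show ?thesis
        using rs lo[OF e, of r] hi[OF e, of s] d(2) i(1) by (auto simp: pin_def split: if_splits)
    qed
    moreover have "pin (insert i A) f e r \<in> V" if "r < k" for r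
    proof -
      have "pin A f d r \<in> V" "pin A f e r \<in> V" using 1 that by (auto simp: valid_def)
      then show ?thesis using d(2) by (auto simp: pin_def split: if_splits)
    qed
    ultimately show ?thesis by (auto simp: valid_def)
  qed
  have "reach k d c" using d(1) c reach_sym by (meson rtranclp_trans)
  then show "reach k c0 (pin (insert i A) f c)"
  proof (induction rule: rtranclp_induct)
    case base
    have "pin (insert i A) f d = pin A f d" using d(2) by (auto simp: pin_def)
    then show ?case using A d(1) by (simp add: pinnable_def)
  next
    case (step e e')
    then obtain r w where rw: "r < k" "overlap (e r) w" "e' = e(r := w)" by (auto simp: slide_def)
    have re: "reach k c0 e" "reach k c0 e'"
      using d(1) step.hyps by (meson rtranclp.rtrancl_into_rtrancl rtranclp_trans)+
    show ?case
    proof (cases "r \<in> insert i A")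
      case True
      then have "pin (insert i A) f e' = pin (insert i A) f e" using rw by (auto simp: pin_def)
      then show ?thesis using step.IH by simp
    next
      case False
      have eq: "pin (insert i A) f e' = (pin (insert i A) f e)(r := w)"
        using rw False by (auto simp: pin_def)
      have "slide k (pin (insert i A) f e) (pin (insert i A) f e')"
        unfolding slide_def
        using v[OF re(1)] v[OF re(2)] rw(1,2) eq False
        by (intro conjI exI[of _ r] exI[of _ w]) (simp_all add: pin_def)
      then show ?thesis using step.IH by auto
    qed
  qed
qed

text \<open>Tokens are pinned from the left, so the only free ones are to the right of the next
  token \<open>a\<close>, and whatever lies to the right of a reachable position of \<open>a\<close>
  lies to the right of its lowest one.\<close>

lemma pinnable_lowest:
  assumes c0: "valid k c0" and f: "\<And>r. r < a \<Longrightarrow> f r = lowest (positions k c0 r)" and "a \<le> k"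
  shows "pinnable k c0 {..<a} f"
  using f \<open>a \<le> k\<close>
proof (induction a)
  case 0
  have "pin {} f c = c" for c by (auto simp: pin_def)
  then show ?case by (simp add: pinnable_def)
next
  case (Suc a)
  have 1: "c a \<in> positions k c0 a" if "reach k c0 c" for c
    using that by (auto simp: positions_def)
  have "pinnable k c0 (insert a {..<a}) f"
  proof (rule pinnable_insert[OF c0])
    show "pinnable k c0 {..<a} f" using Suc by simp
    show "f a \<in> positions k c0 a" using Suc.prems lowest_position(1)[OF c0] by simp
    show "f a \<sqsubset> c l" if "reach k c0 c" "a < l" "l < k" for c l
      using Suc.prems lowest_position(2)[OF c0, of a] 1[OF that(1)]
        valid_prec[OF reach_valid[OF that(1) c0] that(2,3)] by simp
  qed auto
  then show ?case by (simp add: lessThan_Suc)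
qed

text \<open>With the lower tokens pinned, the upper ones are pinned from \<open>k - 1\<close>
  downwards, so that all free tokens are to the left of the next one. The bound
  \<open>a < k - r\<close> leaves token \<open>r\<close> free.\<close>

lemma pinnable_lowest_highest:
  assumes c0: "valid k c0" and lo: "\<And>l. l < r \<Longrightarrow> f l = lowest (positions k c0 l)"
    and hi: "\<And>l. r < l \<Longrightarrow> f l = highest (positions k c0 l)" and r: "r < k" and "a < k - r"
  shows "pinnable k c0 ({..<r} \<union> {k - a..<k}) f"
  using \<open>a < k - r\<close>
proof (induction a)
  case 0
  then show ?case using pinnable_lowest[OF c0 lo] r by simp
next
  case (Suc a)
  define b where "b = k - Suc a"
  have b: "r < b" "b < k" "k - a = Suc b" using Suc.prems by (auto simp: b_def)
  have 1: "c b \<in> positions k c0 b" if "reach k c0 c" for c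
    using that by (auto simp: positions_def)
  have "pinnable k c0 (insert b ({..<r} \<union> {Suc b..<k})) f"
  proof (rule pinnable_insert[OF c0])
    show "pinnable k c0 ({..<r} \<union> {Suc b..<k}) f" using Suc b by simp
    show "f b \<in> positions k c0 b" using b hi[OF b(1)] highest_position(1)[OF c0] by simp
    show "c l \<sqsubset> f b" if "reach k c0 c" "l < b" "b < k" for c l
      using hi[OF b(1)] highest_position(2)[OF c0, of b] 1[OF that(1)]
        valid_prec[OF reach_valid[OF that(1) c0] that(2,3)] b by simp
  qed (use b in auto)
  moreover have "insert b ({..<r} \<union> {Suc b..<k}) = {..<r} \<union> {k - Suc a..<k}"
    using b by (auto simp: b_def)
  ultimately show ?case by simp
qed

text \<open>With all tokens pinned, nothing of \<open>c\<close> remains below \<open>k\<close>: the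
  result is a canonical configuration of the component, determined by the position sets.\<close>

lemma reach_lowest:
  assumes "valid k c"
  shows "reach k c (pin {..<k} (\<lambda>r. lowest (positions k c r)) c)"
  using pinnable_lowest[OF assms, of k] by (auto simp: pinnable_def)

text \<open>To perform the step, park the lower tokens at their lowest and the higher tokens at their
  highest reachable positions.\<close>

lemma positions_step:
  assumes c0: "valid k c0" and r: "r < k" and u: "u \<in> positions k c0 r" "overlap u w"
    and lo: "\<And>l. l < r \<Longrightarrow> \<exists>x\<in>positions k c0 l. x \<sqsubset> w"
    and hi: "\<And>l. r < l \<Longrightarrow> l < k \<Longrightarrow> \<exists>x\<in>positions k c0 l. w \<sqsubset> x"
  shows "w \<in> positions k c0 r"
proof -
  define f where "f l = (if l < r then lowest (positions k c0 l) else highest (positions k c0 l))" for l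
  define A where "A = {..<r} \<union> {Suc r..<k}"
  \<comment> \<open>For \<open>a = k - Suc r\<close> the pinned tokens are exactly those other than
    \<open>r\<close>.\<close>
  have "k - (k - Suc r) = Suc r" using r by simp
  then have pin: "pinnable k c0 A f"
    using pinnable_lowest_highest[OF c0, of r f "k - Suc r"] r by (simp add: f_def A_def)
  obtain c where c: "reach k c0 c" "c r = u" using u(1) by (auto simp: positions_def)
  let ?d = "pin A f c"
  have d: "reach k c0 ?d" "valid k ?d"
    using pin c reach_valid[OF _ c0] by (auto simp: pinnable_def)
  have dr: "?d r = u" using c by (simp add: pin_def A_def)
  have lo': "?d l \<sqsubset> w" if "l < r" for l
    using lo[OF that] lowest_position(2)[OF c0, of l] that r by (auto simp: pin_def A_def f_def)
  have hi': "w \<sqsubset> ?d l" if "r < l" "l < k" for l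
    using hi[OF that] highest_position(2)[OF c0, of l] that by (auto simp: pin_def A_def f_def)
  have "valid k (?d(r := w))"
    using d(2) lo' hi' u(2) by (auto simp: valid_def overlap_def)
  then have "slide k ?d (?d(r := w))"
    using d(2) r u(2) dr unfolding slide_def by blast
  then have "reach k c0 (?d(r := w))" using d(1) by simp
  then show ?thesis unfolding positions_def by (auto intro!: exI[of _ "?d(r := w)"])
qed

end

section \<open>The pair closure\<close>

type_synonym 'a pair_fact = "('a \<times> 'a) \<times> ('a \<times> 'a)"

text \<open>In an interval order this is comparability with the direction forgotten, which is all
  that an adjacency matrix reveals.\<close>

definition apart :: "('a \<Rightarrow> 'a \<Rightarrow> bool) \<Rightarrow> 'a \<Rightarrow> 'a \<Rightarrow> bool" where
  "apart adj x y \<longleftrightarrow> x \<noteq> y \<and> \<not> adj x y"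

text \<open>A fact \<open>((i, u), (j, w))\<close> with \<open>i \<noteq> j\<close> asserts that the token starting at \<open>i\<close> can reach \<open>u\<close>, that
  the one starting at \<open>j\<close> can reach \<open>w\<close>, and that \<open>u\<close>, \<open>w\<close> are in the same left-to-right order as
  \<open>i\<close>, \<open>j\<close>. In a fact \<open>((i, u), (i, w))\<close> the second component is idle, \<open>w = i\<close>, and only the
  reachability of \<open>u\<close> is asserted.\<close>

fun derivable :: "('a \<Rightarrow> 'a \<Rightarrow> bool) \<Rightarrow> 'a set \<Rightarrow> 'a set \<Rightarrow> 'a pair_fact set \<Rightarrow> 'a pair_fact \<Rightarrow> bool" where
  "derivable adj V I T ((i, u), (j, w)) \<longleftrightarrow>
     (i \<in> I \<and> i = u \<and> j \<in> I \<and> j = w) \<or>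
     (i \<noteq> j \<and> ((j, w), (i, u)) \<in> T) \<or>
     ((i = j \<or> apart adj w u) \<and>
      (\<exists>u0\<in>V. adj u0 u \<and> ((i, u0), (j, w)) \<in> T \<and>
        (\<forall>l\<in>V. l \<notin> I \<or> l = i \<or> (\<exists>x\<in>V. ((i, u0), (l, x)) \<in> T \<and> apart adj x u))))"

definition derive_step :: "('a \<Rightarrow> 'a \<Rightarrow> bool) \<Rightarrow> 'a set \<Rightarrow> 'a set \<Rightarrow> 'a pair_fact set \<Rightarrow> 'a pair_fact set" where
  "derive_step adj V I T = {q \<in> (V \<times> V) \<times> (V \<times> V). derivable adj V I T q}"

text \<open>One round per possible fact is enough: until the set is stable, each round adds at least
  one of the \<open>card V ^ 4\<close> quadruples.\<close>

definition pair_closure :: "('a \<Rightarrow> 'a \<Rightarrow> bool) \<Rightarrow> 'a set \<Rightarrow> 'a set \<Rightarrow> 'a pair_fact set" where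
  "pair_closure adj V I = (derive_step adj V I ^^ card V ^ 4) {}"

lemma mono_derive_step: "mono (derive_step adj V I)"
proof (rule monoI)
  fix S T :: "'a pair_fact set" assume "S \<subseteq> T"
  have "derivable adj V I T ((i, u), (j, w))" if "derivable adj V I S ((i, u), (j, w))" for i u j w
  proof -
    \<comment> \<open>\<open>T\<close> occurs only positively in the rules, so the implication can
      be pushed through the connectives; these two rules carry it through the quantifiers over
      \<open>V\<close>.\<close>
    have bex_imp: "(\<And>x. P x \<longrightarrow> Q x) \<Longrightarrow> (\<exists>x\<in>V. P x) \<longrightarrow> (\<exists>x\<in>V. Q x)"
      and ball_imp: "(\<And>x. P x \<longrightarrow> Q x) \<Longrightarrow> (\<forall>x\<in>V. P x) \<longrightarrow> (\<forall>x\<in>V. Q x)" for P Q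
      by blast+
    have *: "q \<in> S \<longrightarrow> q \<in> T" for q using \<open>S \<subseteq> T\<close> by blast
    show ?thesis
      by (rule mp[OF _ that], unfold derivable.simps) (intro disj_mono conj_mono bex_imp ball_imp imp_refl *)
  qed
  then show "derive_step adj V I S \<subseteq> derive_step adj V I T" by (auto simp: derive_step_def)
qed

lemma derive_step_pair_closure:
  assumes "finite V"
  shows "derive_step adj V I (pair_closure adj V I) = pair_closure adj V I"
proof -
  define f where "f m = (derive_step adj V I ^^ m) {}" for m
  let ?Q = "(V \<times> V) \<times> (V \<times> V)"
  have Suc: "f (Suc m) = derive_step adj V I (f m)" for m by (simp add: f_def)
  have sub: "f m \<subseteq> ?Q" for m by (cases m) (auto simp: f_def derive_step_def)
  have fin: "finite ?Q" using assms by simp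
  have "f m \<subseteq> f (Suc m)" for m
    unfolding f_def using funpow_mono2[OF mono_derive_step, of m "Suc m" "{}" "{}"] by simp
  then have mono: "mono f" by (simp add: mono_iff_le_Suc)
  have range: "finite (range f)"
    by (rule finite_subset[of _ "Pow ?Q"]) (use sub fin in auto)
  have "f (card ?Q) = (\<Union>m. f m)"
    by (rule finite_mono_strict_prefix_implies_finite_fixpoint[OF sub fin])
      (rule finite_mono_remains_stable_implies_strict_prefix[OF range mono], simp add: Suc)
  moreover have "card ?Q = card V ^ 4"
    by (simp add: card_cartesian_product power4_eq_xxxx mult.assoc)
  ultimately have union: "f (card V ^ 4) = (\<Union>m. f m)" by simp
  then have "f (Suc (card V ^ 4)) \<subseteq> f (card V ^ 4)" by blast
  moreover have "f (card V ^ 4) \<subseteq> f (Suc (card V ^ 4))" using mono by (simp add: mono_def)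
  ultimately show ?thesis unfolding pair_closure_def by (simp add: f_def)
qed

section \<open>Soundness and completeness of the pair closure\<close>

context interval_order
begin

text \<open>The invariant of the saturation. The two positions may be reached in different
  configurations; only their order is tied to the order of the tokens.\<close>

definition sound :: "nat \<Rightarrow> (nat \<Rightarrow> 'a) \<Rightarrow> 'a pair_fact \<Rightarrow> bool" where
  "sound k c q \<longleftrightarrow> (\<exists>r<k. \<exists>s<k. \<exists>u w. q = ((c r, u), (c s, w)) \<and> u \<in> positions k c r \<and>
     (if r = s then w = c s
      else w \<in> positions k c s \<and> (r < s \<longrightarrow> u \<sqsubset> w) \<and> (s < r \<longrightarrow> w \<sqsubset> u)))"

lemma soundD:
  assumes "sound k c ((c r, u), (c s, w))" "valid k c" "r < k" "s < k"
  shows "u \<in> positions k c r" "r = s \<Longrightarrow> w = c s" "r \<noteq> s \<Longrightarrow> w \<in> positions k c s"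
    "r < s \<Longrightarrow> u \<sqsubset> w" "s < r \<Longrightarrow> w \<sqsubset> u"
proof -
  obtain r' s' where *: "r' < k" "s' < k" "c r = c r'" "c s = c s'" "u \<in> positions k c r'"
    "if r' = s' then w = c s'
      else w \<in> positions k c s' \<and> (r' < s' \<longrightarrow> u \<sqsubset> w) \<and> (s' < r' \<longrightarrow> w \<sqsubset> u)"
    using assms(1) unfolding sound_def by blast
  \<comment> \<open>Facts name tokens by their starting vertices, and injectivity of
    \<open>c\<close> below \<open>k\<close> recovers the indices.\<close>
  have "r' = r" "s' = s"
    using * assms valid_inj_on[OF assms(2)] by (auto simp: inj_on_def)
  with *(5,6) show "u \<in> positions k c r" "r = s \<Longrightarrow> w = c s" "r \<noteq> s \<Longrightarrow> w \<in> positions k c s"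
    "r < s \<Longrightarrow> u \<sqsubset> w" "s < r \<Longrightarrow> w \<sqsubset> u"
    by (simp_all split: if_splits)
qed

text \<open>In a move from \<open>u0\<close> to \<open>u\<close>, the witness \<open>x\<close> for a
  token is on that token's side of \<open>u0\<close>; being apart from \<open>u\<close>, it is on
  the same side of \<open>u\<close>. This supplies the hypotheses of \<open>positions_step\<close>.
  The same argument with \<open>w\<close> in place of \<open>x\<close> preserves the order asserted
  by the fact.\<close>

lemma sound_derivable:
  assumes c: "valid k c" and T: "\<And>q. q \<in> T \<Longrightarrow> sound k c q"
    and q: "derivable overlap V (c ` {..<k}) T q"
  shows "sound k c q"
proof -
  obtain i u j w where q_eq[simp]: "q = ((i, u), (j, w))" by (metis surj_pair)
  have start: "c r \<in> positions k c r" for r by (auto simp: positions_def)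
  consider "i \<in> c ` {..<k}" "i = u" "j \<in> c ` {..<k}" "j = w"
    | "i \<noteq> j" "((j, w), (i, u)) \<in> T"
    | u0 where "i = j \<or> apart overlap w u" "overlap u0 u" "((i, u0), (j, w)) \<in> T"
        "\<forall>l\<in>V. l \<notin> c ` {..<k} \<or> l = i \<or> (\<exists>x\<in>V. ((i, u0), (l, x)) \<in> T \<and> apart overlap x u)"
    using q[unfolded q_eq derivable.simps] by blast
  then show ?thesis
  proof cases
    case 1
    then obtain r s where "r < k" "s < k" "u = c r" "w = c s" by auto
    then show ?thesis using 1 start valid_prec[OF c, of r s] valid_prec[OF c, of s r]
      unfolding sound_def by (intro exI[of _ r] exI[of _ s] conjI) auto
  next
    case 2
    from T[OF 2(2)] obtain r s where "r < k" "s < k" "j = c r" "i = c s" "r \<noteq> s"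
      "w \<in> positions k c r" "u \<in> positions k c s" "r < s \<longrightarrow> w \<sqsubset> u" "s < r \<longrightarrow> u \<sqsubset> w"
      using 2(1) unfolding sound_def by (auto split: if_splits)
    then show ?thesis unfolding sound_def by (intro exI[of _ s] exI[of _ r] conjI) auto
  next
    case 3
    from T[OF 3(3)] obtain r s where rs: "r < k" "s < k" "i = c r" "j = c s"
      unfolding sound_def by blast
    note D = soundD[OF T[OF 3(3), unfolded rs] c rs(1,2)]
    have ne: "c l \<noteq> c r" if "l < k" "l \<noteq> r" for l
      using valid_inj_on[OF c] that rs(1) by (auto simp: inj_on_def)
    have other: "\<exists>x. sound k c ((c r, u0), (c l, x)) \<and> apart overlap x u" if "l < k" "l \<noteq> r" for l
    proof -
      have "c l \<in> V" using c that by (auto simp: valid_def)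
      then have "\<exists>x\<in>V. ((i, u0), (c l, x)) \<in> T \<and> apart overlap x u"
        using 3(4) that ne[OF that] rs(3) by blast
      then show ?thesis using T rs(3) by blast
    qed
    have "u \<in> positions k c r"
    proof (rule positions_step[OF c rs(1) D(1) 3(2)])
      fix l assume l: "l < r"
      then obtain x where x: "sound k c ((c r, u0), (c l, x))" "apart overlap x u"
        using other[of l] rs(1) by auto
      note X = soundD[OF x(1) c rs(1)]
      have "x \<sqsubset> u0" "x \<in> positions k c l" using X l rs(1) by auto
      then show "\<exists>x\<in>positions k c l. x \<sqsubset> u"
        using overlap_prec_left[OF _ 3(2), of x] x(2) by (auto simp: apart_def)
    next
      fix l assume l: "r < l" "l < k"
      then obtain x where x: "sound k c ((c r, u0), (c l, x))" "apart overlap x u"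
        using other[of l] by auto
      note X = soundD[OF x(1) c rs(1) l(2)]
      have "u0 \<sqsubset> x" "x \<in> positions k c l" using X l by auto
      then show "\<exists>x\<in>positions k c l. u \<sqsubset> x"
        using overlap_prec_right[OF _ 3(2), of x] x(2) by (auto simp: apart_def)
    qed
    moreover have "w \<noteq> u \<and> \<not> overlap w u" if "r \<noteq> s"
      using 3(1) ne[of s] that rs by (auto simp: apart_def)
    moreover have "r < s \<Longrightarrow> u \<sqsubset> w"
      using calculation(2) D(4) overlap_prec_right[OF _ 3(2), of w] by simp
    moreover have "s < r \<Longrightarrow> w \<sqsubset> u"
      using calculation(2) D(5) overlap_prec_left[OF _ 3(2), of w] by simp
    ultimately show ?thesis
      using D(2,3) rs unfolding sound_def by (intro exI[of _ r] exI[of _ s] conjI) auto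
  qed
qed

lemma sound_pair_closure:
  assumes "valid k c" "q \<in> pair_closure overlap V (c ` {..<k})"
  shows "sound k c q"
proof -
  have "\<forall>q \<in> (derive_step overlap V (c ` {..<k}) ^^ m) {}. sound k c q" for m
  proof (induction m)
    case (Suc m)
    have "sound k c q"
      if "q \<in> derive_step overlap V (c ` {..<k}) ((derive_step overlap V (c ` {..<k}) ^^ m) {})" for q
    proof (rule sound_derivable[OF assms(1)])
      show "derivable overlap V (c ` {..<k}) ((derive_step overlap V (c ` {..<k}) ^^ m) {}) q"
        using that by (subst (asm) derive_step_def) blast
    qed (use Suc in blast)
    then show ?case by simp
  qed simp
  then show ?thesis using assms(2) by (simp add: pair_closure_def)
qed

text \<open>Induction along the slides: all facts of the current configuration are present, and its
  own positions serve as the witnesses required by the next move.\<close>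

lemma pair_closure_complete:
  assumes c: "valid k c" and d: "reach k c d" and "r < k" "s < k"
  shows "((c r, d r), (c s, if r = s then c s else d s)) \<in> pair_closure overlap V (c ` {..<k})"
  using d assms(3,4)
proof (induction arbitrary: r s rule: rtranclp_induct)
  let ?T = "pair_closure overlap V (c ` {..<k})"
  have I: "q \<in> ?T" if "derivable overlap V (c ` {..<k}) ?T q" "q \<in> (V \<times> V) \<times> (V \<times> V)" for q
    using derive_step_pair_closure[OF finite_V] that by (auto simp: derive_step_def)
  {
    case base
    show ?case by (rule I) (use base c in \<open>auto simp: valid_def\<close>)
  next
    case (step d e)
    have dV: "c r \<in> V" "d r \<in> V" "e r \<in> V" if "r < k" for r
      using that c step(2) by (auto simp: slide_def valid_def)
    obtain t w where t: "t < k" "overlap (d t) w" "e = d(t := w)"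
      and v: "valid k e" using step(2) by (auto simp: slide_def)
    have ne: "c l \<noteq> c l'" if "l < k" "l' < k" "l \<noteq> l'" for l l'
      using valid_inj_on[OF c] that by (auto simp: inj_on_def)
    \<comment> \<open>Tokens \<open>l\<close> and \<open>t\<close> stand at \<open>d l\<close> and
      \<open>w\<close> in the valid configuration \<open>e\<close>.\<close>
    have ap: "apart overlap (d l) w" if "l < k" "l \<noteq> t" for l
      using that valid_prec[OF v, of l t] valid_prec[OF v, of t l] t prec_irrefl
      by (cases l t rule: linorder_cases) (auto simp: apart_def overlap_def)
    have "\<exists>x\<in>V. ((c t, d t), (l, x)) \<in> ?T \<and> apart overlap x w"
      if "l \<in> c ` {..<k}" "l \<noteq> c t" for l
    proof -
      obtain l' where l': "l = c l'" "l' < k" "l' \<noteq> t" using \<open>l \<in> c ` {..<k}\<close> \<open>l \<noteq> c t\<close> by auto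
      then show ?thesis using step.IH[of t l'] t(1) ap dV(2)
        by (intro bexI[of _ "d l'"]) auto
    qed
    then have free: "\<forall>l\<in>V. l \<notin> c ` {..<k} \<or> l = c t \<or>
        (\<exists>x\<in>V. ((c t, d t), (l, x)) \<in> ?T \<and> apart overlap x w)"
      by blast
    have moved: "((c t, w), (c s, if t = s then c s else d s)) \<in> ?T" if "s < k" for s
    proof (rule I)
      have "c t = c s \<or> apart overlap (if t = s then c s else d s) w" using ap[of s] that by auto
      then show "derivable overlap V (c ` {..<k}) ?T ((c t, w), (c s, if t = s then c s else d s))"
        unfolding derivable.simps using free step.IH[OF t(1) that] t(2) dV(2)[OF t(1)] by blast
    qed (use t dV that in \<open>auto simp: overlap_def\<close>)
    \<comment> \<open>The move rule changes only the first component, so a fact with the moved token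
      in second place comes from the exchange rule.\<close>
    have swapped: "((c r, d r), (c t, w)) \<in> ?T" if "r < k" "r \<noteq> t" for r
    proof (rule I)
      show "derivable overlap V (c ` {..<k}) ?T ((c r, d r), (c t, w))"
        unfolding derivable.simps using moved[of r] ne[of r t] that t(1) by auto
    qed (use t dV that in \<open>auto simp: overlap_def\<close>)
    show ?case
      using moved[of s] swapped[of r] step.IH[of r s] step.prems t by auto
  }
qed

text \<open>The purpose of the idle facts: they give the position set of one token without choosing
  a partner, also when there is only one token.\<close>

lemma pair_closure_positions:
  assumes "valid k c" "r < k"
  shows "{u. ((c r, u), (c r, c r)) \<in> pair_closure overlap V (c ` {..<k})} = positions k c r"
proof (intro equalityI subsetI)
  fix u assume "u \<in> positions k c r"
  then show "u \<in> {u. ((c r, u), (c r, c r)) \<in> pair_closure overlap V (c ` {..<k})}"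
    using pair_closure_complete[OF assms(1) _ assms(2,2)] by (auto simp: positions_def)
next
  fix u assume "u \<in> {u. ((c r, u), (c r, c r)) \<in> pair_closure overlap V (c ` {..<k})}"
  then have "sound k c ((c r, u), (c r, c r))" by (intro sound_pair_closure[OF assms(1)]) simp
  then show "u \<in> positions k c r" using soundD(1) assms by blast
qed

end

section \<open>Interval graphs\<close>

locale interval_ordered_graph = interval_order "pverts G" prec
  for G :: "'a pair_pre_digraph" and prec :: "'a \<Rightarrow> 'a \<Rightarrow> bool" (infix "\<sqsubset>" 50) +
  assumes parcs_iff: "(u, v) \<in> parcs G \<longleftrightarrow> overlap u v"

text \<open>One vertex precedes another when all points of its interval are below all points of the
  other. This treats open, closed and unbounded intervals alike.\<close>

lemma interval_graph_order:
  assumes "interval_graph G"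
  shows "\<exists>prec. interval_ordered_graph G prec"
proof -
  obtain S :: "'a \<Rightarrow> real set" where G: "pair_graph G"
    and S: "\<forall>v\<in>pverts G. is_interval (S v) \<and> S v \<noteq> {}"
      "\<forall>u\<in>pverts G. \<forall>v\<in>pverts G. u \<noteq> v \<longrightarrow> ((u, v) \<in> parcs G \<longleftrightarrow> S u \<inter> S v \<noteq> {})"
    using assms unfolding interval_graph_def by (elim conjE exE)
  interpret pair_graph G by fact
  define prec where "prec u v \<longleftrightarrow> u \<in> pverts G \<and> v \<in> pverts G \<and> (\<forall>x\<in>S u. \<forall>y\<in>S v. x < y)" for u v
  interpret interval_order "pverts G" prec
  proof
    show "\<not> prec x x" for x using S(1) unfolding prec_def by blast
    show "prec x z" if "prec x y" "prec y z" for x y z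
      using that S(1) unfolding prec_def by (meson ex_in_conv less_trans)
    show "prec a d \<or> prec c b" if ab: "prec a b" "prec c d" for a b c d
    proof (rule ccontr)
      assume "\<not> ?thesis"
      then obtain x y x' y' where "x \<in> S a" "y \<in> S d" "\<not> x < y" "x' \<in> S c" "y' \<in> S b" "\<not> x' < y'"
        using ab unfolding prec_def by blast
      \<comment> \<open>Together with \<open>y \<le> x\<close> and \<open>y' \<le> x'\<close> this
        closes the cycle \<open>x < y' \<le> x' < y \<le> x\<close>.\<close>
      then have "x < y'" "x' < y" using ab unfolding prec_def by blast+
      then show False using \<open>\<not> x < y\<close> \<open>\<not> x' < y'\<close> by linarith
    qed
  qed (auto simp: prec_def)
  have disj: "S u \<inter> S v = {} \<longleftrightarrow> prec u v \<or> prec v u" if uv: "u \<in> pverts G" "v \<in> pverts G" for u v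
  proof
    assume d: "S u \<inter> S v = {}"
    obtain a b where a: "a \<in> S u" and b: "b \<in> S v" using S(1) uv by blast
    have I: "is_interval (S u)" "is_interval (S v)" using S(1) uv by auto
    have mem: "z \<in> S t" if "is_interval (S t)" "x \<in> S t" "y \<in> S t" "x \<le> z" "z \<le> y" for t x y z
      using that unfolding is_interval_1 by blast
    show "prec u v \<or> prec v u"
    proof (rule ccontr)
      assume "\<not> ?thesis"
      then obtain x y x' y' where *: "x \<in> S u" "y \<in> S v" "y \<le> x" "x' \<in> S u" "y' \<in> S v" "x' \<le> y'"
        using uv unfolding prec_def by (meson not_less)
      \<comment> \<open>In the three cases the common point of the two intervals is
        \<open>y\<close>, \<open>x\<close> and \<open>x'\<close>, respectively.\<close>
      have "x' \<le> y \<or> x \<le> y' \<or> (y < x' \<and> y' < x)" by linarith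
      then show False
      proof (elim disjE conjE)
        assume "x' \<le> y" then show False using mem[OF I(1) *(4,1), of y] * d by blast
      next
        assume "x \<le> y'" then show False using mem[OF I(2) *(2,5), of x] * d by blast
      next
        assume "y < x'" then show False using mem[OF I(2) *(2,5), of x'] * d by 
          (meson disjoint_iff less_imp_le)
      qed
    qed
  next
    assume "prec u v \<or> prec v u"
    then show "S u \<inter> S v = {}" unfolding prec_def by force
  qed
  have "(u, v) \<in> parcs G \<longleftrightarrow> overlap u v" for u v
  proof (cases "u \<in> pverts G \<and> v \<in> pverts G \<and> u \<noteq> v")
    case True
    then show ?thesis using S(2) disj[of u v] by (auto simp: overlap_def)
  next
    case False
    then show ?thesis
      using wellformed[of "(u, v)"] pair_no_loops[of "(u, v)"] by (auto simp: overlap_def)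
  qed
  then have "interval_ordered_graph G prec" by unfold_locales
  then show ?thesis by blast
qed

section \<open>Independent sets as configurations listed from left to right\<close>

context interval_ordered_graph
begin

lemma valid_independent:
  assumes "valid k c"
  shows "c ` {..<k} \<in> independent_sets G k"
proof -
  have "card (c ` {..<k}) = k" using valid_inj_on[OF assms] by (simp add: card_image)
  moreover have "\<not> overlap (c r) (c s)" if "r < k" "s < k" for r s
    using valid_prec[OF assms, of r s] valid_prec[OF assms, of s r] that
    by (cases r s rule: linorder_cases) (auto simp: overlap_def)
  ultimately show ?thesis
    using assms by (auto simp: independent_sets_def parcs_iff valid_def)
qed

lemma ex_enumeration:
  assumes "I \<in> independent_sets G k"
  shows "\<exists>c. valid k c \<and> c ` {..<k} = I"
  using assms
proof (induction k arbitrary: I)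
  case 0
  then have "I = {}"
    using finite_V by (auto simp: independent_sets_def dest: finite_subset)
  then show ?case by (auto simp: valid_def)
next
  case (Suc k)
  have sub: "I \<subseteq> pverts G" and card: "card I = Suc k"
    and ind: "\<And>u v. u \<in> I \<Longrightarrow> v \<in> I \<Longrightarrow> \<not> overlap u v"
    using Suc.prems by (auto simp: independent_sets_def parcs_iff)
  have fin: "finite I" using sub finite_V by (rule finite_subset)
  \<comment> \<open>This becomes the last token: every other \<open>y\<close> in \<open>I\<close> is
    comparable with \<open>x\<close>, and \<open>x \<sqsubset> y\<close> would give
    \<open>x \<sqsubset> x\<close>.\<close>
  obtain x where x: "x \<in> I" "\<And>y z. y \<in> I \<Longrightarrow> z \<sqsubset> y \<Longrightarrow> z \<sqsubset> x"
    using ex_highest[OF fin] card by fastforce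
  have "y \<sqsubset> x" if "y \<in> I - {x}" for y
    using that x ind[of y x] sub prec_irrefl by (auto simp: overlap_def)
  moreover have "I - {x} \<in> independent_sets G k"
    using Suc.prems x(1) fin by (auto simp: independent_sets_def)
  then obtain c where c: "valid k c" "c ` {..<k} = I - {x}" using Suc.IH by blast
  ultimately have "c r \<sqsubset> x" if "r < k" for r using that by blast
  then have "valid (Suc k) (c(k := x))"
    using c(1) x(1) sub by (auto simp: valid_def less_Suc_eq)
  moreover have "(c(k := x)) ` {..<Suc k} = insert x (c ` {..<k})"
    by (auto simp: lessThan_Suc image_iff)
  then have "(c(k := x)) ` {..<Suc k} = I" using c(2) x(1) by auto
  ultimately show ?case by blast
qed

lemma image_update:
  assumes "valid k c" "r < k"
  shows "(c(r := w)) ` {..<k} = insert w (c ` {..<k} - {c r})"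
  using valid_inj_on[OF assms(1)] assms(2) by (auto simp: inj_on_def image_iff)

lemma slide_arc:
  assumes "slide k c d"
  shows "(c ` {..<k}, d ` {..<k}) \<in> parcs (TS k G)"
proof -
  obtain r w where v: "valid k c" "valid k d" and r: "r < k" "overlap (c r) w" "d = c(r := w)"
    using assms by (auto simp: slide_def)
  have ind: "c ` {..<k} \<in> independent_sets G k"
    using v valid_independent by auto
  have "w \<notin> c ` {..<k}"
    using ind r by (auto simp: independent_sets_def parcs_iff)
  then have "c ` {..<k} - d ` {..<k} = {c r}" "d ` {..<k} - c ` {..<k} = {w}"
    using r image_update[OF v(1) r(1), of w] by auto
  then show ?thesis
    using ind valid_independent[OF v(2)] overlap_sym[OF r(2)] by (auto simp: TS_def parcs_iff)
qed

text \<open>Sliding preserves the order of the tokens: \<open>u\<close> overlaps \<open>v\<close>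
  and is apart from all other tokens, so it has each of them on the same side as \<open>v\<close>
  does. Hence entry \<open>r\<close> can be overwritten without renumbering.\<close>

lemma arc_slide:
  assumes "(I, J) \<in> parcs (TS k G)" "valid k c" "c ` {..<k} = I"
  shows "\<exists>d. slide k c d \<and> d ` {..<k} = J"
proof -
  obtain u v where uv: "I - J = {v}" "J - I = {u}" "overlap u v"
    and J: "J \<in> independent_sets G k"
    using assms(1) by (auto simp: TS_def parcs_iff)
  have "v \<in> c ` {..<k}" using uv(1) assms(3) by blast
  then obtain r where r: "r < k" "c r = v" by blast
  have eq: "(c(r := u)) ` {..<k} = J"
    using image_update[OF assms(2) r(1), of u] uv assms(3) r(2) by auto
  have ov: "overlap (c r) u" using uv(3) overlap_sym r by simp
  have ne: "c s \<noteq> u \<and> \<not> overlap (c s) u" if "s < k" "s \<noteq> r" for s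
  proof -
    have "c s \<in> J" using eq that by (metis fun_upd_other imageI lessThan_iff)
    moreover have "c s \<noteq> u" using that uv(2) assms(3) by auto
    moreover have "u \<in> J" using uv(2) by auto
    ultimately show ?thesis using J by (auto simp: independent_sets_def parcs_iff)
  qed
  have "c s \<sqsubset> u" if "s < r" for s
    using overlap_prec_left[OF valid_prec[OF assms(2) that r(1)] ov] ne[of s] that r(1) by auto
  moreover have "u \<sqsubset> c s" if "r < s" "s < k" for s
    using overlap_prec_right[OF valid_prec[OF assms(2) that] ov] ne[of s] that by auto
  ultimately have "valid k (c(r := u))"
    using assms(2) uv(3) r(1) by (auto simp: valid_def overlap_def)
  then have "slide k c (c(r := u))" using assms(2) r(1) ov unfolding slide_def by blast
  then show ?thesis using eq by blast
qed

end

section \<open>Components of the reconfiguration graph and reachability\<close>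

lemma same_component_iff_reachable:
  assumes "pair_graph H"
  shows "same_component H x y \<longleftrightarrow> x \<rightarrow>\<^sup>*\<^bsub>with_proj H\<^esub> y"
proof
  interpret pair_graph H by fact
  show "x \<rightarrow>\<^sup>*\<^bsub>with_proj H\<^esub> y" if "same_component H x y"
    using that by (auto simp: same_component_def in_sccs_verts_conv_reachable)
  assume xy: "x \<rightarrow>\<^sup>*\<^bsub>with_proj H\<^esub> y"
  \<comment> \<open>Since arcs are symmetric, any two vertices reachable from \<open>x\<close> reach
    each other through \<open>x\<close>.\<close>
  let ?C = "{v. x \<rightarrow>\<^sup>*\<^bsub>with_proj H\<^esub> v}"
  have "x \<rightarrow>\<^sup>*\<^bsub>with_proj H\<^esub> x" using xy by (auto elim: reachable_in_vertsE)
  moreover have "?C \<in> pre_digraph.sccs_verts (with_proj H)"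
    unfolding in_sccs_verts_conv_reachable
  proof (intro conjI ballI allI impI)
    fix u v assume "u \<in> ?C" "v \<in> ?C"
    then show "u \<rightarrow>\<^sup>*\<^bsub>with_proj H\<^esub> v"
      using symmetric_reachable'[of x u] reachable_trans[of u x v] by simp
  next
    fix u v assume "u \<in> ?C" "v \<notin> ?C"
    then show "\<not> u \<rightarrow>\<^sup>*\<^bsub>with_proj H\<^esub> v \<or> \<not> v \<rightarrow>\<^sup>*\<^bsub>with_proj H\<^esub> u"
      using reachable_trans[of x u v] by auto
  qed (use calculation in blast)
  ultimately show "same_component H x y"
    using xy unfolding same_component_def by (intro bexI[of _ ?C]) simp_all
qed

context interval_ordered_graph
begin

lemma same_component_reach:
  assumes G: "pair_graph G" and "reach k c d" "valid k c"
  shows "same_component (TS k G) (c ` {..<k}) (d ` {..<k})"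
proof -
  interpret T: pair_graph "TS k G" using pair_graph_TS[OF G] .
  have "(c ` {..<k}) \<rightarrow>\<^sup>*\<^bsub>with_proj (TS k G)\<^esub> (d ` {..<k})"
    using assms(2)
  proof (induction rule: rtranclp_induct)
    case base
    have "c ` {..<k} \<in> pverts (TS k G)" using valid_independent[OF assms(3)] by (simp add: TS_def)
    then show ?case by (intro T.reachable_refl) simp
  next
    case (step d e)
    then show ?case using slide_arc[OF step(2)] T.reachable_adj_trans by auto
  qed
  then show ?thesis by (simp add: same_component_iff_reachable[OF T.pair_graph_axioms])
qed

lemma reach_same_component:
  assumes G: "pair_graph G" and "same_component (TS k G) I J" "valid k c" "c ` {..<k} = I"
  shows "\<exists>d. reach k c d \<and> d ` {..<k} = J"
proof -
  interpret T: pair_graph "TS k G" using pair_graph_TS[OF G] .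
  have "I \<rightarrow>\<^sup>*\<^bsub>with_proj (TS k G)\<^esub> J"
    using assms(2) by (simp add: same_component_iff_reachable[OF T.pair_graph_axioms])
  then show ?thesis
  proof (induction rule: T.reachable_induct)
    case base
    then show ?case using assms(4) by blast
  next
    case (step J K)
    then obtain d where d: "reach k c d" "d ` {..<k} = J" by blast
    have "(J, K) \<in> parcs (TS k G)" using step(2) by simp
    from arc_slide[OF this reach_valid[OF d(1) assms(3)] d(2)]
    obtain e where "slide k d e" "e ` {..<k} = K" by blast
    then show ?case using rtranclp.rtrancl_into_rtrancl[OF d(1)] by blast
  qed
qed

lemma lowest_image:
  assumes "valid k c"
  shows "\<exists>d. reach k c d \<and> d ` {..<k} = (\<lambda>r. lowest (positions k c r)) ` {..<k}"
  by (intro exI conjI, rule reach_lowest[OF assms]) (simp add: pin_def)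

text \<open>Slides do not change the position set of token \<open>r\<close>, which matches
  \<open>c r\<close> with \<open>d r\<close>. Conversely, tokens with equal position sets are parked
  at the same vertex, so the parking places for \<open>I\<close> are among those for
  \<open>J\<close>. Both sets have \<open>k\<close> elements, hence they are equal and the two
  components share a vertex. The criterion does not mention the order of the tokens, so the program
  can test it.\<close>

lemma same_component_iff_positions:
  assumes G: "pair_graph G" and I: "I \<in> independent_sets G k" and J: "J \<in> independent_sets G k"
  defines "K A i \<equiv> {u. ((i, u), (i, i)) \<in> pair_closure (\<lambda>u v. (u, v) \<in> parcs G) (pverts G) A}"
  shows "same_component (TS k G) I J \<longleftrightarrow> (\<forall>i\<in>I. \<exists>j\<in>J. K I i = K J j)"
proof -
  have K: "K (c ` {..<k}) (c r) = positions k c r" if "valid k c" "r < k" for c r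
    using pair_closure_positions[OF that] unfolding K_def parcs_iff .
  obtain c where c: "valid k c" "c ` {..<k} = I" using ex_enumeration[OF I] by blast
  show ?thesis
  proof
    assume "same_component (TS k G) I J"
    then obtain d where d: "reach k c d" "d ` {..<k} = J"
      using reach_same_component[OF G _ c] by blast
    have "K I (c r) = K J (d r)" if "r < k" for r
      using K[OF c(1) that] K[OF reach_valid[OF d(1) c(1)] that] positions_eq[OF d(1)] c d by simp
    then show "\<forall>i\<in>I. \<exists>j\<in>J. K I i = K J j" using c(2) d(2) by blast
  next
    assume *: "\<forall>i\<in>I. \<exists>j\<in>J. K I i = K J j"
    obtain d where d: "valid k d" "d ` {..<k} = J" using ex_enumeration[OF J] by blast
    obtain c' where c': "reach k c c'" "c' ` {..<k} = (\<lambda>r. lowest (positions k c r)) ` {..<k}"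
      using lowest_image[OF c(1)] by blast
    obtain d' where d': "reach k d d'" "d' ` {..<k} = (\<lambda>r. lowest (positions k d r)) ` {..<k}"
      using lowest_image[OF d(1)] by blast
    have "c' ` {..<k} \<subseteq> d' ` {..<k}"
      unfolding c'(2) d'(2)
    proof (rule image_subsetI)
      fix r assume "r \<in> {..<k}"
      then have r: "r < k" by simp
      then obtain s where "s < k" "K I (c r) = K J (d s)" using * c(2) d(2) by blast
      then have "positions k c r = positions k d s" using K[OF c(1) r] K[OF d(1)] c(2) d(2) by simp
      then show "lowest (positions k c r) \<in> (\<lambda>r. lowest (positions k d r)) ` {..<k}"
        using \<open>s < k\<close> by auto
    qed
    moreover have "card (c' ` {..<k}) = card (d' ` {..<k})"
      using valid_inj_on[OF reach_valid[OF c'(1) c(1)]] valid_inj_on[OF reach_valid[OF d'(1) d(1)]]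
      by (simp add: card_image)
    ultimately have eq: "c' ` {..<k} = d' ` {..<k}" by (intro card_subset_eq) auto
    interpret T: pair_graph "TS k G" using pair_graph_TS[OF G] .
    have "same_component (TS k G) I (c' ` {..<k})" "same_component (TS k G) (c' ` {..<k}) J"
      using same_component_reach[OF G c'(1) c(1)] c(2) d(2) eq
        same_component_reach[OF G reach_sym[OF d'(1)] reach_valid[OF d'(1) d(1)]] by simp_all
    then show "same_component (TS k G) I J"
      unfolding same_component_iff_reachable[OF T.pair_graph_axioms] by (rule T.reachable_trans)
  qed
qed

end

section \<open>Running times of expressions\<close>

text \<open>An upper bound in place of the exact time: bounds can be rounded up, and the two
  branches of a conditional can share one.\<close>

definition ev :: "program \<Rightarrow> sexp list \<Rightarrow> expr \<Rightarrow> sexp \<Rightarrow> nat \<Rightarrow> bool" where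
  "ev P env e v T \<longleftrightarrow> (\<exists>t\<le>T. eval P env e v t)"

definition evs :: "program \<Rightarrow> sexp list \<Rightarrow> expr list \<Rightarrow> sexp list \<Rightarrow> nat \<Rightarrow> bool" where
  "evs P env es vs T \<longleftrightarrow> (\<exists>t\<le>T. evals P env es vs t)"

lemma ev_mono: "ev P env e v T \<Longrightarrow> T \<le> T' \<Longrightarrow> ev P env e v T'"
  unfolding ev_def by (meson order_trans)

lemma ev_Cons:
  "ev P env a v S \<Longrightarrow> ev P env b w T \<Longrightarrow> ev P env (MkCons a b) (SCons v w) (S + T + 1)"
  unfolding ev_def by (meson add_le_mono eval_Cons order_refl)

lemma ev_Cond:
  assumes "ev P env e v S" "v \<noteq> SNil \<Longrightarrow> ev P env a w T" "v = SNil \<Longrightarrow> ev P env b w T"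
  shows "ev P env (Cond e a b) w (S + T + 1)"
  using assms unfolding ev_def
  by (metis add_le_mono eval_Cond_then eval_Cond_else order_refl)

lemma evs_Nil: "evs P env [] [] 0"
  unfolding evs_def by (blast intro: evals_Nil)

lemma evs_Cons: "ev P env e v S \<Longrightarrow> evs P env es vs T \<Longrightarrow> evs P env (e # es) (v # vs) (S + T)"
  unfolding ev_def evs_def by (meson add_le_mono evals_Cons)

lemma ev_Call:
  assumes "evs P env es vs S" "f < length P" "ev P vs (P ! f) v T"
  shows "ev P env (Call f es) v (S + T + 1)"
  using assms unfolding ev_def evs_def by (meson add_le_mono eval_Call order_refl)

text \<open>Without conditionals and calls, the cost does not depend on the environment; value and
  cost are then computed by simplification with \<open>aval\<close> and
  \<open>acost\<close>.\<close>

fun atomic :: "nat \<Rightarrow> expr \<Rightarrow> bool" where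
  "atomic m (Var i) \<longleftrightarrow> i < m"
| "atomic m MkNil \<longleftrightarrow> True"
| "atomic m (MkCons a b) \<longleftrightarrow> atomic m a \<and> atomic m b"
| "atomic m (Hd e) \<longleftrightarrow> atomic m e"
| "atomic m (Tl e) \<longleftrightarrow> atomic m e"
| "atomic m (Cond e a b) \<longleftrightarrow> False"
| "atomic m (Call f es) \<longleftrightarrow> False"

fun aval :: "sexp list \<Rightarrow> expr \<Rightarrow> sexp" where
  "aval env (Var i) = env ! i"
| "aval env (MkCons a b) = SCons (aval env a) (aval env b)"
| "aval env (Hd e) = shd (aval env e)"
| "aval env (Tl e) = stl (aval env e)"
| "aval env e = SNil"

fun acost :: "expr \<Rightarrow> nat" where
  "acost (MkCons a b) = acost a + acost b + 1"
| "acost (Hd e) = acost e + 1"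
| "acost (Tl e) = acost e + 1"
| "acost e = 1"

lemma eval_atomic: "atomic (length env) e \<Longrightarrow> eval P env e (aval env e) (acost e)"
proof (induction e)
  case (Var i) then show ?case using eval_Var[of i env P] by simp
next
  case MkNil then show ?case using eval_Nil[of P env] by simp
qed (auto intro: eval_Cons eval_Hd eval_Tl simp del: One_nat_def add_Suc_right)

lemma ev_atomic: "atomic (length env) e \<Longrightarrow> aval env e = v \<Longrightarrow> ev P env e v (acost e)"
  unfolding ev_def using eval_atomic by blast

lemma evs_atomic:
  "list_all (atomic (length env)) es \<Longrightarrow> evs P env es (map (aval env) es) (sum_list (map acost es))"
  by (induction es) (simp_all add: evs_Nil evs_Cons ev_atomic)

lemma ev_call_atomic:
  assumes "ev P vs (P ! f) v T" "f < length P" "map (aval env) es = vs"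
    "list_all (atomic (length env)) es"
  shows "ev P env (Call f es) v (sum_list (map acost es) + T + 1)"
  using ev_Call[OF evs_atomic[OF assms(4)] assms(2)] assms(1,3) by simp

lemma ev_Cond_atomic_true:
  assumes "ev P env a v T" "atomic (length env) e" "aval env e \<noteq> SNil" "acost e + T + 1 \<le> T'"
  shows "ev P env (Cond e a b) v T'"
  using ev_mono[OF ev_Cond[OF ev_atomic[OF assms(2) refl] assms(1)] assms(4)] assms(3) by blast

lemma ev_Cond_atomic_false:
  assumes "ev P env b v T" "atomic (length env) e" "aval env e = SNil" "acost e + T + 1 \<le> T'"
  shows "ev P env (Cond e a b) v T'"
  using ev_mono[OF ev_Cond[OF ev_atomic[OF assms(2) refl] _ assms(1)] assms(4)] assms(3) by blast

section \<open>Boolean connectives and quantifiers over lists\<close>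

definition true_expr :: expr where
  "true_expr = MkCons MkNil MkNil"

definition not_expr :: "expr \<Rightarrow> expr" where
  "not_expr e = Cond e MkNil true_expr"

definition and_expr :: "expr \<Rightarrow> expr \<Rightarrow> expr" where
  "and_expr a b = Cond a b MkNil"

definition or_expr :: "expr \<Rightarrow> expr \<Rightarrow> expr" where
  "or_expr a b = Cond a true_expr b"

lemma encode_bool_simps [simp]:
  "encode_bool True = SCons SNil SNil" "encode_bool False = SNil"
  by (simp_all add: encode_bool_def)

lemma encode_bool_eq_SNil [simp]: "encode_bool b = SNil \<longleftrightarrow> \<not> b"
  by (simp add: encode_bool_def)

lemma ev_true: "ev P env true_expr (encode_bool True) 3"
  by (rule ev_mono, rule ev_atomic) (simp_all add: true_expr_def)

lemma ev_false: "ev P env MkNil (encode_bool False) 1"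
  by (rule ev_mono, rule ev_atomic) simp_all

lemma ev_not:
  assumes "ev P env e (encode_bool a) T"
  shows "ev P env (not_expr e) (encode_bool (\<not> a)) (T + 4)"
  unfolding not_expr_def
  \<comment> \<open>The costlier branch is \<open>true_expr\<close>, with 3 steps.\<close>
  by (rule ev_mono[OF ev_Cond[OF assms, where T = 3]])
    (auto intro: ev_mono[OF ev_true] ev_mono[OF ev_false] simp del: encode_bool_simps)

lemma ev_and:
  assumes "ev P env e (encode_bool a) S" "a \<Longrightarrow> ev P env e' (encode_bool b) T"
  shows "ev P env (and_expr e e') (encode_bool (a \<and> b)) (S + T + 2)"
  unfolding and_expr_def
  by (rule ev_mono[OF ev_Cond[OF assms(1), where T = "T + 1"]])
    (use ev_mono[OF assms(2)] ev_mono[OF ev_false] in \<open>auto simp del: encode_bool_simps\<close>)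

lemma ev_or:
  assumes "ev P env e (encode_bool a) S" "\<not> a \<Longrightarrow> ev P env e' (encode_bool b) T"
  shows "ev P env (or_expr e e') (encode_bool (a \<or> b)) (S + T + 4)"
  unfolding or_expr_def
  by (rule ev_mono[OF ev_Cond[OF assms(1), where T = "T + 3"]])
    (use ev_mono[OF assms(2)] ev_mono[OF ev_true] in \<open>auto simp del: encode_bool_simps\<close>)

lemma encode_list_simps [simp]:
  "encode_list [] = SNil" "encode_list (x # xs) = SCons x (encode_list xs)"
  by (simp_all add: encode_list_def)

text \<open>The language is first-order, so each bounded quantifier is a recursive function of its
  own: \<open>f\<close> is its own number, and the \<open>m\<close> parameters after the list are
  handed on unchanged.\<close>

definition all_loop :: "nat \<Rightarrow> nat \<Rightarrow> expr \<Rightarrow> expr" where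
  "all_loop f m b =
     Cond (Var 0) (and_expr b (Call f (Tl (Var 0) # map Var [1..<Suc m]))) true_expr"

definition ex_loop :: "nat \<Rightarrow> nat \<Rightarrow> expr \<Rightarrow> expr" where
  "ex_loop f m b =
     Cond (Var 0) (or_expr b (Call f (Tl (Var 0) # map Var [1..<Suc m]))) MkNil"

lemma loop_args:
  defines "es m \<equiv> Tl (Var 0) # map Var [1..<Suc m]"
  shows "map (aval (SCons x y # ctx)) (es (length ctx)) = y # ctx"
    "list_all (atomic (length (SCons x y # ctx))) (es (length ctx))"
    "sum_list (map acost (es (length ctx))) = length ctx + 2"
proof -
  have "map ((!) (SCons x y # ctx)) [1..<Suc (length ctx)] = ctx"
    by (rule nth_equalityI) (auto simp del: upt_Suc)
  then show "map (aval (SCons x y # ctx)) (es (length ctx)) = y # ctx"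
    by (simp add: es_def comp_def del: upt_Suc)
  show "list_all (atomic (length (SCons x y # ctx))) (es (length ctx))"
    by (auto simp: es_def list_all_iff simp del: upt_Suc)
  show "sum_list (map acost (es (length ctx))) = length ctx + 2"
    by (simp add: es_def comp_def sum_list_triv del: upt_Suc)
qed

text \<open>Each round costs \<open>T\<close> for the test, \<open>m + 2\<close> for the arguments
  of the recursive call and a few steps for the connectives. The constant 10 is large enough for
  \<open>ex_loop\<close> too, where the total overhead is \<open>m + 9\<close>. The test must
  succeed for every \<open>rest\<close>, as it may look only at the head.\<close>

lemma ev_all_loop:
  assumes f: "f < length P" and body: "P ! f = all_loop f m b" and m: "length ctx = m"
    and b: "\<And>x rest. x \<in> set xs \<Longrightarrow> ev P (SCons (enc x) rest # ctx) b (encode_bool (Q x)) T"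
  shows "ev P (encode_list (map enc xs) # ctx) (P ! f) (encode_bool (\<forall>x\<in>set xs. Q x))
    ((T + m + 10) * Suc (length xs))"
  using b
proof (induction xs)
  case Nil
  show ?case unfolding body all_loop_def
    by (rule ev_Cond_atomic_false, use ev_true[of P "SNil # ctx"] in simp) auto
next
  case (Cons x xs)
  note call = ev_call_atomic[OF Cons.IH[OF Cons.prems] f loop_args(1,2), unfolded loop_args(3), unfolded m]
  have "ev P (encode_list (map enc (x # xs)) # ctx)
      (and_expr b (Call f (Tl (Var 0) # map Var [1..<Suc m])))
      (encode_bool (Q x \<and> (\<forall>x\<in>set xs. Q x)))
      (T + (m + 2 + (T + m + 10) * Suc (length xs) + 1) + 2)"
    unfolding list.map encode_list_simps by (intro ev_and call Cons.prems) simp_all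
  then show ?case unfolding body all_loop_def
    by (intro ev_Cond_atomic_true) auto
qed

lemma ev_ex_loop:
  assumes f: "f < length P" and body: "P ! f = ex_loop f m b" and m: "length ctx = m"
    and b: "\<And>x rest. x \<in> set xs \<Longrightarrow> ev P (SCons (enc x) rest # ctx) b (encode_bool (Q x)) T"
  shows "ev P (encode_list (map enc xs) # ctx) (P ! f) (encode_bool (\<exists>x\<in>set xs. Q x))
    ((T + m + 10) * Suc (length xs))"
  using b
proof (induction xs)
  case Nil
  show ?case unfolding body ex_loop_def
    by (rule ev_Cond_atomic_false, use ev_false[of P "SNil # ctx"] in simp) auto
next
  case (Cons x xs)
  note call = ev_call_atomic[OF Cons.IH[OF Cons.prems] f loop_args(1,2), unfolded loop_args(3), unfolded m]
  have "ev P (encode_list (map enc (x # xs)) # ctx)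
      (or_expr b (Call f (Tl (Var 0) # map Var [1..<Suc m])))
      (encode_bool (Q x \<or> (\<exists>x\<in>set xs. Q x)))
      (T + (m + 2 + (T + m + 10) * Suc (length xs) + 1) + 4)"
    unfolding list.map encode_list_simps by (intro ev_or call Cons.prems) simp_all
  then show ?case unfolding body ex_loop_def
    by (intro ev_Cond_atomic_true) auto
qed

section \<open>The program\<close>

abbreviation (input) "EQUAL \<equiv> 1 :: nat"
abbreviation (input) "NTH \<equiv> 2 :: nat"
abbreviation (input) "LENGTH \<equiv> 3 :: nat"
abbreviation (input) "RANGE \<equiv> 4 :: nat"
abbreviation (input) "PAIRS \<equiv> 5 :: nat"
abbreviation (input) "PRODUCT \<equiv> 6 :: nat"
abbreviation (input) "MEMBER \<equiv> 7 :: nat"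
abbreviation (input) "ADJ \<equiv> 8 :: nat"
abbreviation (input) "APART \<equiv> 9 :: nat"
abbreviation (input) "EX_POS \<equiv> 10 :: nat"
abbreviation (input) "ALL_TOKENS \<equiv> 11 :: nat"
abbreviation (input) "EX_PRED \<equiv> 12 :: nat"
abbreviation (input) "DERIVABLE \<equiv> 13 :: nat"
abbreviation (input) "DERIVE \<equiv> 14 :: nat"
abbreviation (input) "ITERATE \<equiv> 15 :: nat"
abbreviation (input) "SAME \<equiv> 16 :: nat"
abbreviation (input) "EX_TOKEN \<equiv> 17 :: nat"
abbreviation (input) "MATCH \<equiv> 18 :: nat"
abbreviation (input) "DECIDE \<equiv> 19 :: nat"

text \<open>The comments name the actual parameters \<open>Var 0, Var 1, \<dots>\<close> of the longer bodies.\<close>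

definition eq_body :: expr where
  "eq_body = Cond (Var 0)
     (Cond (Var 1)
       (and_expr (Call EQUAL [Hd (Var 0), Hd (Var 1)]) (Call EQUAL [Tl (Var 0), Tl (Var 1)])) MkNil)
     (not_expr (Var 1))"

definition nth_body :: expr where \<comment> \<open>list, unary index\<close>
  "nth_body = Cond (Var 1) (Call NTH [Tl (Var 0), Tl (Var 1)]) (Hd (Var 0))"

definition num_body :: expr where
  "num_body = Cond (Var 0) (MkCons MkNil (Call LENGTH [Tl (Var 0)])) MkNil"

text \<open>Applied to the adjacency matrix, which has one row per vertex: the lengths of the proper
  tails are the vertices in descending order.\<close>

definition range_body :: expr where
  "range_body = Cond (Var 0)
     (MkCons (Call LENGTH [Tl (Var 0)]) (Call RANGE [Tl (Var 0)])) MkNil"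

definition pairs_body :: expr where
  "pairs_body = Cond (Var 1)
     (MkCons (MkCons (Var 0) (Hd (Var 1))) (Call PAIRS [Var 0, Tl (Var 1), Var 2])) (Var 2)"

definition product_body :: expr where
  "product_body = Cond (Var 0)
     (Call PAIRS [Hd (Var 0), Var 1, Call PRODUCT [Tl (Var 0), Var 1]]) MkNil"

definition member_body :: expr where
  "member_body = ex_loop MEMBER 1 (Call EQUAL [Hd (Var 0), Var 1])"

definition adj_body :: expr where
  "adj_body = Call NTH [Call NTH [Var 0, Var 1], Var 2]"

definition apart_body :: expr where \<comment> \<open>\<open>x, u\<close>, matrix\<close>
  "apart_body = and_expr (not_expr (Call EQUAL [Var 0, Var 1]))
     (not_expr (Call ADJ [Var 2, Var 0, Var 1]))"

definition ex_pos_body :: expr where \<comment> \<open>list of vertices \<open>x\<close>; \<open>l, i, u0, u\<close>, table, matrix\<close>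
  "ex_pos_body = ex_loop EX_POS 6
     (and_expr
       (Call MEMBER [Var 5, MkCons (MkCons (Var 2) (Var 3)) (MkCons (Var 1) (Hd (Var 0)))])
       (Call APART [Hd (Var 0), Var 4, Var 6]))"

definition all_tokens_body :: expr where
  \<comment> \<open>list of vertices \<open>l\<close>; \<open>i, u0, u\<close>, table, matrix, start set, vertices\<close>
  "all_tokens_body = all_loop ALL_TOKENS 7
     (or_expr (not_expr (Call NTH [Var 6, Hd (Var 0)]))
       (or_expr (Call EQUAL [Hd (Var 0), Var 1])
         (Call EX_POS [Var 7, Hd (Var 0), Var 1, Var 2, Var 3, Var 4, Var 5])))"

definition ex_pred_body :: expr where
  \<comment> \<open>list of vertices \<open>u0\<close>; fact, table, matrix, start set, vertices\<close>
  "ex_pred_body = ex_loop EX_PRED 5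
     (and_expr (Call ADJ [Var 3, Hd (Var 0), Tl (Hd (Var 1))])
       (and_expr (Call MEMBER [Var 2, MkCons (MkCons (Hd (Hd (Var 1))) (Hd (Var 0))) (Tl (Var 1))])
         (Call ALL_TOKENS [Var 5, Hd (Hd (Var 1)), Hd (Var 0), Tl (Hd (Var 1)),
            Var 2, Var 3, Var 4, Var 5])))"

definition derivable_body :: expr where \<comment> \<open>fact, table, matrix, start set, vertices\<close>
  "derivable_body =
     (let i = Hd (Hd (Var 0)); u = Tl (Hd (Var 0)); j = Hd (Tl (Var 0)); w = Tl (Tl (Var 0)) in
      or_expr
        (and_expr (Call NTH [Var 3, i])
          (and_expr (Call EQUAL [i, u]) (and_expr (Call NTH [Var 3, j]) (Call EQUAL [j, w]))))
      (or_expr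
        (and_expr (not_expr (Call EQUAL [i, j])) (Call MEMBER [Var 1, MkCons (Tl (Var 0)) (Hd (Var 0))]))
        (and_expr (or_expr (Call EQUAL [i, j]) (Call APART [w, u, Var 2]))
          (Call EX_PRED [Var 4, Var 0, Var 1, Var 2, Var 3, Var 4]))))"

definition derive_body :: expr where \<comment> \<open>list of facts; table, matrix, start set, vertices\<close>
  "derive_body = Cond (Var 0)
     (Cond (Call DERIVABLE [Hd (Var 0), Var 1, Var 2, Var 3, Var 4])
       (MkCons (Hd (Var 0)) (Call DERIVE [Tl (Var 0), Var 1, Var 2, Var 3, Var 4]))
       (Call DERIVE [Tl (Var 0), Var 1, Var 2, Var 3, Var 4]))
     MkNil"

definition iterate_body :: expr where
  \<comment> \<open>list as loop counter; table, all facts, matrix, start set, vertices\<close>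
  "iterate_body = Cond (Var 0)
     (Call ITERATE [Tl (Var 0), Call DERIVE [Var 2, Var 1, Var 3, Var 4, Var 5],
        Var 2, Var 3, Var 4, Var 5])
     (Var 1)"

definition same_body :: expr where \<comment> \<open>list of vertices \<open>x\<close>; \<open>i, j\<close>, two tables\<close>
  "same_body = all_loop SAME 4
     (let a = Call MEMBER [Var 3, MkCons (MkCons (Var 1) (Hd (Var 0))) (MkCons (Var 1) (Var 1))];
          b = Call MEMBER [Var 4, MkCons (MkCons (Var 2) (Hd (Var 0))) (MkCons (Var 2) (Var 2))]
      in Cond a b (not_expr b))"

definition ex_token_body :: expr where \<comment> \<open>list of vertices \<open>j\<close>; \<open>i\<close>, target set, two tables, vertices\<close>
  "ex_token_body = ex_loop EX_TOKEN 5
     (and_expr (Call NTH [Var 2, Hd (Var 0)]) (Call SAME [Var 5, Var 1, Hd (Var 0), Var 3, Var 4]))"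

definition match_body :: expr where
  \<comment> \<open>list of vertices \<open>i\<close>; start set, target set, two tables, vertices\<close>
  "match_body = all_loop MATCH 5
     (or_expr (not_expr (Call NTH [Var 1, Hd (Var 0)]))
       (Call EX_TOKEN [Var 5, Hd (Var 0), Var 2, Var 3, Var 4, Var 5]))"

definition decide_body :: expr where \<comment> \<open>matrix, start set, target set, vertices, all facts\<close>
  "decide_body = Call MATCH [Var 3, Var 1, Var 2,
     Call ITERATE [Var 4, MkNil, Var 4, Var 0, Var 1, Var 3],
     Call ITERATE [Var 4, MkNil, Var 4, Var 0, Var 2, Var 3], Var 3]"

text \<open>The \<open>let\<close> belongs to HOL and copies its expression to every occurrence. In
  the language a value is bound only by passing it as a parameter, which is the purpose of the call
  of \<open>DECIDE\<close>.\<close>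

definition main_body :: expr where
  "main_body =
     (let v = Call RANGE [Hd (Var 0)]; v2 = Call PRODUCT [v, v] in
      Call DECIDE [Hd (Var 0), Hd (Tl (Var 0)), Hd (Tl (Tl (Var 0))), v, Call PRODUCT [v2, v2]])"

definition prog :: program where
  "prog = [main_body, eq_body, nth_body, num_body, range_body, pairs_body, product_body,
     member_body, adj_body, apart_body, ex_pos_body, all_tokens_body, ex_pred_body,
     derivable_body, derive_body, iterate_body, same_body, ex_token_body, match_body, decide_body]"

lemma prog_nth:
  "prog ! 0 = main_body" "prog ! EQUAL = eq_body" "prog ! NTH = nth_body" "prog ! LENGTH = num_body"
  "prog ! RANGE = range_body" "prog ! PAIRS = pairs_body" "prog ! PRODUCT = product_body"
  "prog ! MEMBER = member_body" "prog ! ADJ = adj_body" "prog ! APART = apart_body"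
  "prog ! EX_POS = ex_pos_body" "prog ! ALL_TOKENS = all_tokens_body"
  "prog ! EX_PRED = ex_pred_body" "prog ! DERIVABLE = derivable_body"
  "prog ! DERIVE = derive_body" "prog ! ITERATE = iterate_body" "prog ! SAME = same_body"
  "prog ! EX_TOKEN = ex_token_body" "prog ! MATCH = match_body" "prog ! DECIDE = decide_body"
  by (simp_all add: prog_def)

lemma length_prog: "length prog = 20"
  by (simp add: prog_def)

section \<open>Unary numbers, encoded facts and the list functions\<close>

definition num :: "nat \<Rightarrow> sexp" where
  "num k = encode_list (replicate k SNil)"

lemma num_simps [simp]: "num 0 = SNil" "num (Suc k) = SCons SNil (num k)"
  by (simp_all add: num_def)

lemma size_num [simp]: "size (num k) = k"
  by (induction k) simp_all

lemma num_inject [simp]: "num i = num j \<longleftrightarrow> i = j"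
  by (metis size_num)

fun encode_pair :: "nat \<times> nat \<Rightarrow> sexp" where
  "encode_pair (i, u) = SCons (num i) (num u)"

fun encode_fact :: "nat pair_fact \<Rightarrow> sexp" where
  "encode_fact (p, q) = SCons (encode_pair p) (encode_pair q)"

lemma encode_fact_inject [simp]: "encode_fact p = encode_fact q \<longleftrightarrow> p = q"
  by (cases p rule: encode_fact.cases; cases q rule: encode_fact.cases) (auto elim!: encode_pair.elims)

text \<open>The recursion ends as soon as either argument does, so the bound involves
  \<open>x\<close> only and the second argument may be of any size.\<close>

lemma eq_ev: "ev prog [x, y] (prog ! EQUAL) (encode_bool (x = y)) (40 * size x + 20)"
proof (induction x arbitrary: y)
  case SNil
  have "ev prog [SNil, y] (not_expr (Var 1)) (encode_bool (SNil = y)) 8"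
    unfolding not_expr_def
    by (rule ev_mono[OF ev_Cond[OF ev_atomic[where v = y], where T = 3]])
      (use ev_true[of prog] ev_mono[OF ev_false[of prog]] in auto)
  then show ?case unfolding prog_nth eq_body_def
    by (rule ev_Cond_atomic_false) simp_all
next
  case (SCons a b)
  have "ev prog [SCons a b, y]
      (Cond (Var 1)
        (and_expr (Call EQUAL [Hd (Var 0), Hd (Var 1)]) (Call EQUAL [Tl (Var 0), Tl (Var 1)])) MkNil)
      (encode_bool (SCons a b = y)) (40 * (size a + size b) + 40 + 14)"
  proof (cases y)
    case SNil
    then show ?thesis
      by (intro ev_Cond_atomic_false[where T = 1]) (use ev_false[of prog] in auto)
  next
    case y: (SCons c d)
    have "ev prog [SCons a b, y]
        (and_expr (Call EQUAL [Hd (Var 0), Hd (Var 1)]) (Call EQUAL [Tl (Var 0), Tl (Var 1)]))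
        (encode_bool (a = c \<and> b = d)) (40 * (size a + size b) + 40 + 12)"
      by (rule ev_mono[OF ev_and[OF ev_call_atomic[OF SCons.IH(1)[of c]] ev_call_atomic[OF SCons.IH(2)[of d]]]])
        (simp_all add: y length_prog)
    then show ?thesis
      by (intro ev_Cond_atomic_true[where T = "40 * (size a + size b) + 40 + 12"]) (auto simp: y)
  qed
  then show ?case unfolding prog_nth eq_body_def
    by (rule ev_Cond_atomic_true) auto
qed

lemma eq_num_ev:
  assumes "i < n"
  shows "ev prog [num i, num j] (prog ! EQUAL) (encode_bool (i = j)) (40 * n + 20)"
  using ev_mono[OF eq_ev[of "num i" "num j"], of "40 * n + 20"] assms by simp

lemma nth_ev:
  "k < length xs \<Longrightarrow> ev prog [encode_list xs, num k] (prog ! NTH) (xs ! k) (10 * k + 10)"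
proof (induction k arbitrary: xs)
  case 0
  then show ?case unfolding prog_nth nth_body_def
    by (cases xs) (auto intro!: ev_Cond_atomic_false[OF ev_atomic])
next
  case (Suc k)
  then obtain x ys where xs: "xs = x # ys" "k < length ys" by (cases xs) auto
  have "ev prog [encode_list xs, num (Suc k)] (Call NTH [Tl (Var 0), Tl (Var 1)]) (ys ! k)
      (10 * k + 15)"
    by (rule ev_mono[OF ev_call_atomic[OF Suc.IH[OF xs(2)]]]) (simp_all add: xs length_prog)
  then show ?case unfolding prog_nth nth_body_def
    by (intro ev_Cond_atomic_true) (auto simp: xs)
qed

lemma set_ev:
  assumes "i < n"
  shows "ev prog [encode_set n A, num i] (prog ! NTH) (encode_bool (i \<in> A)) (10 * n + 10)"
  using ev_mono[OF nth_ev[of i "map (\<lambda>v. encode_bool (v \<in> A)) [0..<n]"]] assms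
  by (simp add: encode_set_def)

lemma num_ev:
  "ev prog [encode_list xs] (prog ! LENGTH) (num (length xs)) (10 * length xs + 10)"
proof (induction xs)
  case Nil
  then show ?case unfolding prog_nth num_body_def
    by (rule ev_Cond_atomic_false[OF ev_atomic]) simp_all
next
  case (Cons x xs)
  have "ev prog [encode_list (x # xs)] (MkCons MkNil (Call LENGTH [Tl (Var 0)]))
      (SCons SNil (num (length xs))) (1 + (10 * length xs + 13) + 1)"
    by (intro ev_Cons ev_mono[OF ev_atomic] ev_mono[OF ev_call_atomic[OF Cons.IH]])
      (simp_all add: length_prog)
  then show ?case unfolding prog_nth num_body_def
    by (intro ev_Cond_atomic_true) auto
qed

lemma range_ev:
  "ev prog [encode_list xs] (prog ! RANGE) (encode_list (map num (rev [0..<length xs])))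
     ((10 * length xs + 30) * Suc (length xs))"
proof (induction xs)
  case Nil
  then show ?case unfolding prog_nth range_body_def
    by (rule ev_Cond_atomic_false[OF ev_atomic]) simp_all
next
  case (Cons x xs)
  have "ev prog [encode_list (x # xs)] (MkCons (Call LENGTH [Tl (Var 0)]) (Call RANGE [Tl (Var 0)]))
      (SCons (num (length xs)) (encode_list (map num (rev [0..<length xs]))))
      ((10 * length xs + 13) + ((10 * length xs + 30) * Suc (length xs) + 3) + 1)"
    by (intro ev_Cons ev_mono[OF ev_call_atomic[OF Cons.IH]] ev_mono[OF ev_call_atomic[OF num_ev[of xs]]])
      (simp_all add: length_prog)
  then show ?case unfolding prog_nth range_body_def
    by (intro ev_Cond_atomic_true) (auto simp: algebra_simps)
qed

lemma pairs_ev: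
  "ev prog [x, encode_list ys, encode_list zs] (prog ! PAIRS)
     (encode_list (map (SCons x) ys @ zs)) (15 * length ys + 15)"
proof (induction ys)
  case Nil
  then show ?case unfolding prog_nth pairs_body_def
    by (intro ev_Cond_atomic_false[OF ev_atomic]) auto
next
  case (Cons y ys)
  have "ev prog [x, encode_list (y # ys), encode_list zs]
      (MkCons (MkCons (Var 0) (Hd (Var 1))) (Call PAIRS [Var 0, Tl (Var 1), Var 2]))
      (SCons (SCons x y) (encode_list (map (SCons x) ys @ zs))) (4 + (15 * length ys + 20) + 1)"
    by (intro ev_Cons[of _ _ _ "SCons x y"] ev_mono[OF ev_atomic] ev_mono[OF ev_call_atomic[OF Cons.IH]])
      (simp_all add: length_prog)
  then show ?case unfolding prog_nth pairs_body_def
    by (intro ev_Cond_atomic_true) auto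
qed

lemma product_ev:
  "ev prog [encode_list (map f xs), encode_list (map g ys)] (prog ! PRODUCT)
     (encode_list (map (\<lambda>(x, y). SCons (f x) (g y)) (List.product xs ys)))
     ((15 * length ys + 50) * Suc (length xs))"
proof (induction xs)
  case Nil
  then show ?case unfolding prog_nth product_body_def
    by (rule ev_Cond_atomic_false[OF ev_atomic]) simp_all
next
  case (Cons x xs)
  let ?env = "[encode_list (map f (x # xs)), encode_list (map g ys)]"
  let ?rest = "encode_list (map (\<lambda>(x, y). SCons (f x) (g y)) (List.product xs ys))"
  have rest: "ev prog ?env (Call PRODUCT [Tl (Var 0), Var 1]) ?rest
      ((15 * length ys + 50) * Suc (length xs) + 4)"
    by (rule ev_mono[OF ev_call_atomic[OF Cons.IH]]) (simp_all add: length_prog)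
  have args: "evs prog ?env [Hd (Var 0), Var 1, Call PRODUCT [Tl (Var 0), Var 1]]
      [f x, encode_list (map g ys), ?rest]
      (2 + (1 + ((15 * length ys + 50) * Suc (length xs) + 4 + 0)))"
    by (intro evs_Cons evs_Nil rest ev_mono[OF ev_atomic]) simp_all
  have eq: "encode_list (map (SCons (f x)) (map g ys) @
        map (\<lambda>(x, y). SCons (f x) (g y)) (List.product xs ys)) =
      encode_list (map (\<lambda>(x, y). SCons (f x) (g y)) (List.product (x # xs) ys))"
    by (simp add: comp_def)
  have "ev prog ?env (Call PAIRS [Hd (Var 0), Var 1, Call PRODUCT [Tl (Var 0), Var 1]])
      (encode_list (map (\<lambda>(x, y). SCons (f x) (g y)) (List.product (x # xs) ys)))
      (15 * length ys + 30 + (15 * length ys + 50) * Suc (length xs))"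
    unfolding eq[symmetric]
    by (rule ev_mono[OF ev_Call[OF args _ pairs_ev]]) (simp_all add: length_prog)
  then show ?case unfolding prog_nth product_body_def
    by (intro ev_Cond_atomic_true) auto
qed

text \<open>Membership of the entries bounds the cost of one comparison; the separate bound on the
  length is needed because a list may repeat entries.\<close>

definition table :: "nat \<Rightarrow> nat pair_fact list \<Rightarrow> bool" where
  "table n ts \<longleftrightarrow> set ts \<subseteq> ({..<n} \<times> {..<n}) \<times> ({..<n} \<times> {..<n}) \<and> length ts \<le> n ^ 4"

definition encode_table :: "nat pair_fact list \<Rightarrow> sexp" where
  "encode_table ts = encode_list (map encode_fact ts)"

text \<open>The descending order is the one in which \<open>RANGE\<close> produces the list.\<close>

definition vertices :: "nat \<Rightarrow> nat list" where
  "vertices n = rev [0..<n]"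

definition encode_vertices :: "nat \<Rightarrow> sexp" where
  "encode_vertices n = encode_list (map num (vertices n))"

lemma set_vertices [simp]: "set (vertices n) = {..<n}"
  by (auto simp: vertices_def)

lemma length_vertices [simp]: "length (vertices n) = n"
  by (simp add: vertices_def)

section \<open>Time bounds, following the nesting of the calls\<close>

definition t_member :: "nat \<Rightarrow> nat" where
  "t_member n = (160 * n + 160) * Suc (n ^ 4)"

definition t_ex_pos :: "nat \<Rightarrow> nat" where
  "t_ex_pos n = (t_member n + 60 * n + 200) * Suc n"

definition t_all_tokens :: "nat \<Rightarrow> nat" where
  "t_all_tokens n = (t_ex_pos n + 60 * n + 200) * Suc n"

definition t_ex_pred :: "nat \<Rightarrow> nat" where
  "t_ex_pred n = (t_all_tokens n + t_member n + 60 * n + 200) * Suc n"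

definition t_derivable :: "nat \<Rightarrow> nat" where
  "t_derivable n = t_ex_pred n + t_member n + 300 * n + 600"

definition t_derive :: "nat \<Rightarrow> nat" where
  "t_derive n = (t_derivable n + 50) * Suc (n ^ 4)"

definition t_iterate :: "nat \<Rightarrow> nat" where
  "t_iterate n = (t_derive n + 50) * Suc (n ^ 4)"

definition t_same :: "nat \<Rightarrow> nat" where
  "t_same n = (2 * t_member n + 100) * Suc n"

definition t_ex_token :: "nat \<Rightarrow> nat" where
  "t_ex_token n = (t_same n + 20 * n + 100) * Suc n"

definition t_match :: "nat \<Rightarrow> nat" where
  "t_match n = (t_ex_token n + 20 * n + 100) * Suc n"

text \<open>The vertex list is computed five times: once for \<open>DECIDE\<close> and twice in each
  of the two copies of the list of pairs. The two small products and the large one account for the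
  remaining quadratic and quartic terms.\<close>

definition t_main :: "nat \<Rightarrow> nat" where
  "t_main n = t_match n + 2 * t_iterate n + 5 * ((10 * n + 30) * Suc n) +
     2 * ((15 * n + 50) * Suc n) + (15 * (n * n) + 50) * Suc (n * n) + 200"

lemma member_ev:
  assumes "table n ts"
  shows "ev prog [encode_table ts, encode_fact q] (prog ! MEMBER) (encode_bool (q \<in> set ts)) (t_member n)"
proof -
  have size: "size (encode_fact p) \<le> 4 * n + 3" if "p \<in> set ts" for p
    using that assms by (cases p rule: encode_fact.cases) (force simp: table_def)
  have "ev prog (encode_list (map encode_fact ts) # [encode_fact q]) (prog ! MEMBER)
      (encode_bool (\<exists>p\<in>set ts. p = q))
      ((160 * n + 145 + 1 + 10) * Suc (length ts))"
  proof (rule ev_ex_loop[OF _ prog_nth(8)[unfolded member_body_def]], goal_cases)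
    case (3 p rest)
    show ?case
      using size[OF 3]
      by (intro ev_mono[OF ev_call_atomic[OF eq_ev[of "encode_fact p" "encode_fact q", unfolded encode_fact_inject]]])
        (simp_all add: length_prog)
  qed (simp_all add: length_prog)
  moreover have "(160 * n + 145 + 1 + 10) * Suc (length ts) \<le> t_member n"
    unfolding t_member_def by (rule mult_le_mono) (use assms in \<open>simp_all add: table_def\<close>)
  ultimately show ?thesis unfolding encode_table_def by (simp add: ev_mono)
qed

section \<open>Functions that consult the graph\<close>

locale encoded_graph =
  fixes G :: "nat pair_pre_digraph" and n :: nat
  assumes pverts_G: "pverts G = {..<n}"
begin

abbreviation adj :: "nat \<Rightarrow> nat \<Rightarrow> bool" where
  "adj u v \<equiv> (u, v) \<in> parcs G"

lemma adj_ev: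
  assumes "u < n" "v < n"
  shows "ev prog [encode_graph G, num u, num v] (prog ! ADJ) (encode_bool (adj u v)) (20 * n + 40)"
proof -
  let ?env = "[encode_graph G, num u, num v]"
  have row: "ev prog ?env (Call NTH [Var 0, Var 1]) (encode_set n {v. adj u v}) (10 * n + 13)"
    using assms nth_ev[of u "map (\<lambda>u. encode_set n {v. adj u v}) [0..<n]"]
    by (intro ev_mono[OF ev_call_atomic[where T = "10 * u + 10"]])
      (simp_all add: length_prog encode_graph_def pverts_G)
  have "evs prog ?env [Call NTH [Var 0, Var 1], Var 2] [encode_set n {v. adj u v}, num v]
      (10 * n + 13 + (1 + 0))"
    by (intro evs_Cons evs_Nil row ev_mono[OF ev_atomic]) simp_all
  from ev_Call[OF this _ set_ev[OF assms(2)]] show ?thesis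
    unfolding prog_nth adj_body_def by (auto intro: ev_mono simp: length_prog)
qed

lemma apart_ev:
  assumes "x < n" "u < n"
  shows "ev prog [num x, num u, encode_graph G] (prog ! APART) (encode_bool (apart adj x u)) (60 * n + 80)"
  unfolding prog_nth apart_body_def apart_def
  by (rule ev_mono[OF ev_and[OF
        ev_not[OF ev_call_atomic[OF eq_num_ev[OF assms(1), of u]]]
        ev_not[OF ev_call_atomic[OF adj_ev[OF assms]]]]])
    (simp_all add: length_prog)

lemma ex_pos_ev:
  assumes ts: "table n ts" and u: "u < n"
  shows "ev prog [encode_vertices n, num l, num i, num u0, num u, encode_table ts, encode_graph G]
    (prog ! EX_POS) (encode_bool (\<exists>x\<in>{..<n}. ((i, u0), (l, x)) \<in> set ts \<and> apart adj x u)) (t_ex_pos n)"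
proof -
  let ?ctx = "[num l, num i, num u0, num u, encode_table ts, encode_graph G]"
  have "ev prog (encode_list (map num (vertices n)) # ?ctx) (prog ! EX_POS)
      (encode_bool (\<exists>x\<in>set (vertices n). ((i, u0), (l, x)) \<in> set ts \<and> apart adj x u))
      ((t_member n + 60 * n + 120 + 6 + 10) * Suc (length (vertices n)))"
  proof (rule ev_ex_loop[OF _ prog_nth(11)[unfolded ex_pos_body_def]], goal_cases)
    case (3 x rest)
    then have "x < n" by simp
    show ?case
      by (rule ev_mono[OF ev_and[OF
            ev_call_atomic[OF member_ev[OF ts, of "((i, u0), (l, x))"]]
            ev_call_atomic[OF apart_ev[OF \<open>x < n\<close> u]]]])
        (simp_all add: length_prog)
  qed (simp_all add: length_prog)
  then show ?thesis unfolding encode_vertices_def t_ex_pos_def set_vertices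
    by (rule ev_mono) (simp del: mult_Suc_right)
qed

lemma all_tokens_ev:
  assumes ts: "table n ts" and u: "u < n"
  shows "ev prog [encode_vertices n, num i, num u0, num u, encode_table ts, encode_graph G,
      encode_set n I, encode_vertices n] (prog ! ALL_TOKENS)
    (encode_bool (\<forall>l\<in>{..<n}. l \<notin> I \<or> l = i \<or>
      (\<exists>x\<in>{..<n}. ((i, u0), (l, x)) \<in> set ts \<and> apart adj x u))) (t_all_tokens n)"
proof -
  let ?ctx = "[num i, num u0, num u, encode_table ts, encode_graph G, encode_set n I, encode_vertices n]"
  have "ev prog (encode_list (map num (vertices n)) # ?ctx) (prog ! ALL_TOKENS)
      (encode_bool (\<forall>l\<in>set (vertices n). l \<notin> I \<or> l = i \<or>
        (\<exists>x\<in>{..<n}. ((i, u0), (l, x)) \<in> set ts \<and> apart adj x u)))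
      ((t_ex_pos n + 60 * n + 100 + 7 + 10) * Suc (length (vertices n)))"
  proof (rule ev_all_loop[OF _ prog_nth(12)[unfolded all_tokens_body_def]], goal_cases)
    case (3 l rest)
    then have l: "l < n" by simp
    show ?case
      by (rule ev_mono[OF ev_or[OF
            ev_not[OF ev_call_atomic[OF set_ev[OF l, of I]]]
            ev_or[OF ev_call_atomic[OF eq_num_ev[OF l, of i]]
              ev_call_atomic[OF ex_pos_ev[OF ts u, of l i u0]]]]])
        (simp_all add: length_prog)
  qed (simp_all add: length_prog)
  then show ?thesis unfolding encode_vertices_def t_all_tokens_def set_vertices
    by (rule ev_mono) (simp del: mult_Suc_right)
qed

lemma ex_pred_ev:
  assumes ts: "table n ts" and u: "u < n"
  shows "ev prog [encode_vertices n, encode_fact ((i, u), (j, w)), encode_table ts, encode_graph G,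
      encode_set n I, encode_vertices n] (prog ! EX_PRED)
    (encode_bool (\<exists>u0\<in>{..<n}. adj u0 u \<and> ((i, u0), (j, w)) \<in> set ts \<and>
      (\<forall>l\<in>{..<n}. l \<notin> I \<or> l = i \<or>
        (\<exists>x\<in>{..<n}. ((i, u0), (l, x)) \<in> set ts \<and> apart adj x u)))) (t_ex_pred n)"
proof -
  let ?ctx = "[encode_fact ((i, u), (j, w)), encode_table ts, encode_graph G, encode_set n I, encode_vertices n]"
  have "ev prog (encode_list (map num (vertices n)) # ?ctx) (prog ! EX_PRED)
      (encode_bool (\<exists>u0\<in>set (vertices n). adj u0 u \<and> ((i, u0), (j, w)) \<in> set ts \<and>
        (\<forall>l\<in>{..<n}. l \<notin> I \<or> l = i \<or>
          (\<exists>x\<in>{..<n}. ((i, u0), (l, x)) \<in> set ts \<and> apart adj x u))))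
      ((t_all_tokens n + t_member n + 60 * n + 120 + 5 + 10) * Suc (length (vertices n)))"
  proof (rule ev_ex_loop[OF _ prog_nth(13)[unfolded ex_pred_body_def]], goal_cases)
    case (3 u0 rest)
    then have u0: "u0 < n" by simp
    show ?case
      by (rule ev_mono[OF ev_and[OF ev_call_atomic[OF adj_ev[OF u0 u]]
            ev_and[OF ev_call_atomic[OF member_ev[OF ts, of "((i, u0), (j, w))"]]
              ev_call_atomic[OF all_tokens_ev[OF ts u, of i u0 I]]]]])
        (simp_all add: length_prog)
  qed (simp_all add: length_prog)
  then show ?thesis unfolding encode_vertices_def t_ex_pred_def set_vertices
    by (rule ev_mono) (simp del: mult_Suc_right)
qed

text \<open>The program text follows \<open>derivable.simps\<close> connective by connective, so the
  running-time rules are nested in the same way as the formula.\<close>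

lemma derivable_ev:
  assumes ts: "table n ts" and q: "i < n" "u < n" "j < n" "w < n"
  shows "ev prog [encode_fact ((i, u), (j, w)), encode_table ts, encode_graph G, encode_set n I,
      encode_vertices n] (prog ! DERIVABLE)
    (encode_bool (derivable adj {..<n} I (set ts) ((i, u), (j, w)))) (t_derivable n)"
  unfolding prog_nth derivable_body_def Let_def derivable.simps
  by (rule ev_mono[OF ev_or[OF
      ev_and[OF ev_call_atomic[OF set_ev[OF q(1), of I]]
        ev_and[OF ev_call_atomic[OF eq_num_ev[OF q(1), of u]]
          ev_and[OF ev_call_atomic[OF set_ev[OF q(3), of I]] ev_call_atomic[OF eq_num_ev[OF q(3), of w]]]]]
      ev_or[OF
        ev_and[OF ev_not[OF ev_call_atomic[OF eq_num_ev[OF q(1), of j]]]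
          ev_call_atomic[OF member_ev[OF ts, of "((j, w), (i, u))"]]]
        ev_and[OF
          ev_or[OF ev_call_atomic[OF eq_num_ev[OF q(1), of j]] ev_call_atomic[OF apart_ev[OF q(4,2)]]]
          ev_call_atomic[OF ex_pred_ev[OF ts q(2), of i j w I]]]]]])
    (simp_all add: length_prog t_derivable_def)

end

definition all_facts :: "nat \<Rightarrow> nat pair_fact list" where
  "all_facts n = List.product (List.product (vertices n) (vertices n)) (List.product (vertices n) (vertices n))"

lemma set_all_facts: "set (all_facts n) = ({..<n} \<times> {..<n}) \<times> ({..<n} \<times> {..<n})"
  by (auto simp: all_facts_def)

lemma length_all_facts: "length (all_facts n) = n ^ 4"
  by (simp add: all_facts_def power4_eq_xxxx mult.assoc)

lemma table_filter_all_facts: "table n (filter R (all_facts n))"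
  using length_filter_le[of R "all_facts n"] set_all_facts[of n]
  by (auto simp: table_def length_all_facts)

lemma encode_table_simps [simp]:
  "encode_table [] = SNil" "encode_table (q # qs) = SCons (encode_fact q) (encode_table qs)"
  by (simp_all add: encode_table_def)

context encoded_graph
begin

definition derive_list :: "nat set \<Rightarrow> nat pair_fact list \<Rightarrow> nat pair_fact list" where
  "derive_list I ts = filter (derivable adj {..<n} I (set ts)) (all_facts n)"

lemma set_derive_list: "set (derive_list I ts) = derive_step adj {..<n} I (set ts)"
  by (auto simp: derive_list_def derive_step_def set_all_facts)

lemma derive_ev:
  assumes ts: "table n ts" and "set qs \<subseteq> ({..<n} \<times> {..<n}) \<times> ({..<n} \<times> {..<n})"
  shows "ev prog [encode_table qs, encode_table ts, encode_graph G, encode_set n I, encode_vertices n]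
    (prog ! DERIVE) (encode_table (filter (derivable adj {..<n} I (set ts)) qs))
    ((t_derivable n + 50) * Suc (length qs))"
  using assms(2)
proof (induction qs)
  case Nil
  then show ?case unfolding prog_nth derive_body_def
    by (intro ev_Cond_atomic_false[OF ev_atomic]) simp_all
next
  case (Cons q qs)
  let ?R = "derivable adj {..<n} I (set ts)"
  let ?env = "[encode_table (q # qs), encode_table ts, encode_graph G, encode_set n I, encode_vertices n]"
  let ?T = "(t_derivable n + 50) * Suc (length qs)"
  obtain i u j w where q: "q = ((i, u), (j, w))" by (metis surj_pair)
  have test: "ev prog ?env (Call DERIVABLE [Hd (Var 0), Var 1, Var 2, Var 3, Var 4])
      (encode_bool (?R q)) (t_derivable n + 7)"
    unfolding q using Cons.prems
    by (intro ev_mono[OF ev_call_atomic[OF derivable_ev[OF ts, of i u j w I]]])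
      (simp_all add: length_prog q)
  have rest: "ev prog ?env (Call DERIVE [Tl (Var 0), Var 1, Var 2, Var 3, Var 4])
      (encode_table (filter ?R qs)) (?T + 7)"
    using Cons.prems
    by (intro ev_mono[OF ev_call_atomic[OF Cons.IH]]) (simp_all add: length_prog)
  have hd: "ev prog ?env (Hd (Var 0)) (encode_fact q) 2"
    by (intro ev_mono[OF ev_atomic]) simp_all
  have "ev prog ?env
     (Cond (Call DERIVABLE [Hd (Var 0), Var 1, Var 2, Var 3, Var 4])
       (MkCons (Hd (Var 0)) (Call DERIVE [Tl (Var 0), Var 1, Var 2, Var 3, Var 4]))
       (Call DERIVE [Tl (Var 0), Var 1, Var 2, Var 3, Var 4]))
     (encode_table (filter ?R (q # qs))) (t_derivable n + 7 + (2 + (?T + 7) + 1) + 1)"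
  proof (rule ev_Cond[OF test])
    assume "encode_bool (?R q) \<noteq> SNil"
    then show "ev prog ?env (MkCons (Hd (Var 0)) (Call DERIVE [Tl (Var 0), Var 1, Var 2, Var 3, Var 4]))
        (encode_table (filter ?R (q # qs))) (2 + (?T + 7) + 1)"
      using ev_Cons[OF hd rest] by simp
  next
    assume "encode_bool (?R q) = SNil"
    then show "ev prog ?env (Call DERIVE [Tl (Var 0), Var 1, Var 2, Var 3, Var 4])
        (encode_table (filter ?R (q # qs))) (2 + (?T + 7) + 1)"
      using ev_mono[OF rest] by simp
  qed
  then show ?case unfolding prog_nth derive_body_def
    by (rule ev_Cond_atomic_true) simp_all
qed

lemma iterate_ev:
  assumes "table n ts"
  shows "ev prog [encode_list xs, encode_table ts, encode_table (all_facts n), encode_graph G,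
      encode_set n I, encode_vertices n] (prog ! ITERATE)
    (encode_table ((derive_list I ^^ length xs) ts)) ((t_derive n + 50) * Suc (length xs))"
  using assms
proof (induction xs arbitrary: ts)
  case Nil
  then show ?case unfolding prog_nth iterate_body_def
    by (intro ev_Cond_atomic_false[OF ev_atomic]) simp_all
next
  case (Cons x xs)
  let ?env = "[encode_list (x # xs), encode_table ts, encode_table (all_facts n), encode_graph G,
      encode_set n I, encode_vertices n]"
  have step: "ev prog ?env (Call DERIVE [Var 2, Var 1, Var 3, Var 4, Var 5])
      (encode_table (derive_list I ts)) (t_derive n + 6)"
    by (rule ev_mono[OF ev_call_atomic[OF derive_ev[OF Cons.prems, of "all_facts n" I, folded derive_list_def]]])
      (simp_all add: length_prog set_all_facts length_all_facts t_derive_def)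
  have args: "evs prog ?env
      [Tl (Var 0), Call DERIVE [Var 2, Var 1, Var 3, Var 4, Var 5], Var 2, Var 3, Var 4, Var 5]
      [encode_list xs, encode_table (derive_list I ts), encode_table (all_facts n), encode_graph G,
        encode_set n I, encode_vertices n] (2 + (t_derive n + 6 + (1 + (1 + (1 + (1 + 0))))))"
    by (intro evs_Cons evs_Nil step ev_mono[OF ev_atomic]) simp_all
  have "table n (derive_list I ts)" unfolding derive_list_def by (rule table_filter_all_facts)
  from ev_Call[OF args _ Cons.IH[OF this]]
  have "ev prog ?env
      (Call ITERATE [Tl (Var 0), Call DERIVE [Var 2, Var 1, Var 3, Var 4, Var 5], Var 2, Var 3, Var 4, Var 5])
      (encode_table ((derive_list I ^^ length xs) (derive_list I ts)))
      (2 + (t_derive n + 6 + (1 + (1 + (1 + (1 + 0))))) + (t_derive n + 50) * Suc (length xs) + 1)"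
    by (simp add: length_prog)
  then show ?case unfolding prog_nth iterate_body_def
    by (intro ev_Cond_atomic_true) (auto simp: funpow_swap1)
qed

definition closure_list :: "nat set \<Rightarrow> nat pair_fact list" where
  "closure_list I = (derive_list I ^^ n ^ 4) []"

lemma table_closure_list: "table n (closure_list I)"
  unfolding closure_list_def derive_list_def
  by (cases "n ^ 4") (simp_all add: table_filter_all_facts, simp add: table_def)

lemma set_closure_list: "set (closure_list I) = pair_closure adj {..<n} I"
proof -
  have "set ((derive_list I ^^ m) []) = (derive_step adj {..<n} I ^^ m) {}" for m
    by (induction m) (simp_all add: set_derive_list)
  then show ?thesis by (simp add: closure_list_def pair_closure_def)
qed

text \<open>The list of all facts appears twice: as the candidates to be filtered, and as a loop
  counter whose length \<open>n ^ 4\<close> is the number of rounds in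
  \<open>pair_closure\<close>.\<close>

lemma closure_ev:
  "ev prog [encode_table (all_facts n), SNil, encode_table (all_facts n), encode_graph G,
      encode_set n I, encode_vertices n] (prog ! ITERATE) (encode_table (closure_list I)) (t_iterate n)"
  using iterate_ev[of "[]" "map encode_fact (all_facts n)" I]
  by (simp add: closure_list_def length_all_facts t_iterate_def table_def flip: encode_table_def)

end

section \<open>Comparing the position sets read off from two tables\<close>

lemma same_ev:
  assumes "table n ts" "table n ts'"
  shows "ev prog [encode_vertices n, num i, num j, encode_table ts, encode_table ts'] (prog ! SAME)
    (encode_bool (\<forall>x\<in>{..<n}. ((i, x), (i, i)) \<in> set ts \<longleftrightarrow> ((j, x), (j, j)) \<in> set ts')) (t_same n)"
proof -
  let ?ctx = "[num i, num j, encode_table ts, encode_table ts']"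
  have "ev prog (encode_list (map num (vertices n)) # ?ctx) (prog ! SAME)
      (encode_bool (\<forall>x\<in>set (vertices n). ((i, x), (i, i)) \<in> set ts \<longleftrightarrow> ((j, x), (j, j)) \<in> set ts'))
      ((2 * t_member n + 50 + 4 + 10) * Suc (length (vertices n)))"
  proof (rule ev_all_loop[OF _ prog_nth(17)[unfolded same_body_def Let_def]], goal_cases)
    case (3 x rest)
    let ?env = "SCons (num x) rest # ?ctx"
    let ?a = "Call MEMBER [Var 3, MkCons (MkCons (Var 1) (Hd (Var 0))) (MkCons (Var 1) (Var 1))]"
    let ?b = "Call MEMBER [Var 4, MkCons (MkCons (Var 2) (Hd (Var 0))) (MkCons (Var 2) (Var 2))]"
    have a: "ev prog ?env ?a (encode_bool (((i, x), (i, i)) \<in> set ts)) (t_member n + 10)"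
      by (rule ev_mono[OF ev_call_atomic[OF member_ev[OF assms(1), of "((i, x), (i, i))"]]])
        (simp_all add: length_prog)
    have b: "ev prog ?env ?b (encode_bool (((j, x), (j, j)) \<in> set ts')) (t_member n + 10)"
      by (rule ev_mono[OF ev_call_atomic[OF member_ev[OF assms(2), of "((j, x), (j, j))"]]])
        (simp_all add: length_prog)
    show ?case
      by (rule ev_mono[OF ev_Cond[OF a, where T = "t_member n + 10 + 4"]])
        (use ev_mono[OF b, of "t_member n + 10 + 4"] ev_not[OF b] in simp_all)
  qed (simp_all add: length_prog)
  then show ?thesis unfolding encode_vertices_def t_same_def set_vertices
    by (rule ev_mono) (simp del: mult_Suc_right)
qed

lemma ex_token_ev:
  assumes ts: "table n ts" "table n ts'"
  shows "ev prog [encode_vertices n, num i, encode_set n J, encode_table ts, encode_table ts',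
      encode_vertices n] (prog ! EX_TOKEN)
    (encode_bool (\<exists>j\<in>{..<n}. j \<in> J \<and>
      (\<forall>x\<in>{..<n}. ((i, x), (i, i)) \<in> set ts \<longleftrightarrow> ((j, x), (j, j)) \<in> set ts'))) (t_ex_token n)"
proof -
  let ?ctx = "[num i, encode_set n J, encode_table ts, encode_table ts', encode_vertices n]"
  have "ev prog (encode_list (map num (vertices n)) # ?ctx) (prog ! EX_TOKEN)
      (encode_bool (\<exists>j\<in>set (vertices n). j \<in> J \<and>
        (\<forall>x\<in>{..<n}. ((i, x), (i, i)) \<in> set ts \<longleftrightarrow> ((j, x), (j, j)) \<in> set ts')))
      ((t_same n + 20 * n + 50 + 5 + 10) * Suc (length (vertices n)))"
  proof (rule ev_ex_loop[OF _ prog_nth(18)[unfolded ex_token_body_def]], goal_cases)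
    case (3 j rest)
    then have j: "j < n" by simp
    show ?case
      by (rule ev_mono[OF ev_and[OF ev_call_atomic[OF set_ev[OF j, of J]]
            ev_call_atomic[OF same_ev[OF ts, of i j]]]])
        (simp_all add: length_prog)
  qed (simp_all add: length_prog)
  then show ?thesis unfolding encode_vertices_def t_ex_token_def set_vertices
    by (rule ev_mono) (simp del: mult_Suc_right)
qed

lemma match_ev:
  assumes ts: "table n ts" "table n ts'"
  shows "ev prog [encode_vertices n, encode_set n I, encode_set n J, encode_table ts,
      encode_table ts', encode_vertices n] (prog ! MATCH)
    (encode_bool (\<forall>i\<in>{..<n}. i \<notin> I \<or> (\<exists>j\<in>{..<n}. j \<in> J \<and>
      (\<forall>x\<in>{..<n}. ((i, x), (i, i)) \<in> set ts \<longleftrightarrow> ((j, x), (j, j)) \<in> set ts')))) (t_match n)"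
proof -
  let ?ctx = "[encode_set n I, encode_set n J, encode_table ts, encode_table ts', encode_vertices n]"
  have "ev prog (encode_list (map num (vertices n)) # ?ctx) (prog ! MATCH)
      (encode_bool (\<forall>i\<in>set (vertices n). i \<notin> I \<or> (\<exists>j\<in>{..<n}. j \<in> J \<and>
        (\<forall>x\<in>{..<n}. ((i, x), (i, i)) \<in> set ts \<longleftrightarrow> ((j, x), (j, j)) \<in> set ts'))))
      ((t_ex_token n + 20 * n + 50 + 5 + 10) * Suc (length (vertices n)))"
  proof (rule ev_all_loop[OF _ prog_nth(19)[unfolded match_body_def]], goal_cases)
    case (3 i rest)
    then have i: "i < n" by simp
    show ?case
      by (rule ev_mono[OF ev_or[OF ev_not[OF ev_call_atomic[OF set_ev[OF i, of I]]]
            ev_call_atomic[OF ex_token_ev[OF ts, of i J]]]])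
        (simp_all add: length_prog)
  qed (simp_all add: length_prog)
  then show ?thesis unfolding encode_vertices_def t_match_def set_vertices
    by (rule ev_mono) (simp del: mult_Suc_right)
qed

context encoded_graph
begin

abbreviation accepts :: "nat set \<Rightarrow> nat set \<Rightarrow> bool" where
  "accepts I J \<equiv> \<forall>i\<in>{..<n}. i \<notin> I \<or> (\<exists>j\<in>{..<n}. j \<in> J \<and>
     (\<forall>x\<in>{..<n}. ((i, x), (i, i)) \<in> set (closure_list I) \<longleftrightarrow>
       ((j, x), (j, j)) \<in> set (closure_list J)))"

lemma decide_ev:
  "ev prog [encode_graph G, encode_set n I, encode_set n J, encode_vertices n, encode_table (all_facts n)]
     (prog ! DECIDE) (encode_bool (accepts I J)) (t_match n + 2 * t_iterate n + 30)"
proof -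
  let ?env = "[encode_graph G, encode_set n I, encode_set n J, encode_vertices n, encode_table (all_facts n)]"
  have I: "ev prog ?env (Call ITERATE [Var 4, MkNil, Var 4, Var 0, Var 1, Var 3])
      (encode_table (closure_list I)) (t_iterate n + 7)"
    by (rule ev_mono[OF ev_call_atomic[OF closure_ev[of I]]]) (simp_all add: length_prog)
  have J: "ev prog ?env (Call ITERATE [Var 4, MkNil, Var 4, Var 0, Var 2, Var 3])
      (encode_table (closure_list J)) (t_iterate n + 7)"
    by (rule ev_mono[OF ev_call_atomic[OF closure_ev[of J]]]) (simp_all add: length_prog)
  have "evs prog ?env
     [Var 3, Var 1, Var 2,
       Call ITERATE [Var 4, MkNil, Var 4, Var 0, Var 1, Var 3],
       Call ITERATE [Var 4, MkNil, Var 4, Var 0, Var 2, Var 3], Var 3]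
     [encode_vertices n, encode_set n I, encode_set n J, encode_table (closure_list I),
       encode_table (closure_list J), encode_vertices n]
     (1 + (1 + (1 + (t_iterate n + 7 + (t_iterate n + 7 + (1 + 0))))))"
    by (intro evs_Cons evs_Nil I J ev_mono[OF ev_atomic]) simp_all
  from ev_Call[OF this _ match_ev[OF table_closure_list table_closure_list, of I J I J]]
  show ?thesis unfolding prog_nth decide_body_def
    by (rule ev_mono) (simp_all add: length_prog)
qed

lemma main_ev:
  "ev prog [encode_list [encode_graph G, encode_set n I, encode_set n J]]
     (prog ! 0) (encode_bool (accepts I J)) (t_main n)"
proof -
  let ?env = "[encode_list [encode_graph G, encode_set n I, encode_set n J]]"
  let ?v = "Call RANGE [Hd (Var 0)]"
  let ?v2 = "Call PRODUCT [?v, ?v]"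
  let ?tv = "(10 * n + 30) * Suc n"
  let ?tv2 = "2 * ?tv + 7 + (15 * n + 50) * Suc n"
  let ?pairs = "List.product (vertices n) (vertices n)"
  have graph: "encode_graph G = encode_list (map (\<lambda>u. encode_set n {v. adj u v}) [0..<n])"
    by (simp add: encode_graph_def pverts_G)
  have v: "ev prog ?env ?v (encode_vertices n) (?tv + 3)"
    unfolding encode_vertices_def vertices_def
    by (rule ev_mono[OF ev_call_atomic[OF range_ev[of "map (\<lambda>u. encode_set n {v. adj u v}) [0..<n]",
              unfolded length_map length_upt diff_zero]]])
      (simp_all add: length_prog graph)
  have "evs prog ?env [?v, ?v] [encode_vertices n, encode_vertices n] (?tv + 3 + (?tv + 3 + 0))"
    by (intro evs_Cons evs_Nil v)
  from ev_Call[OF this[unfolded encode_vertices_def] _ product_ev]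
  have "ev prog ?env ?v2 (encode_list (map (\<lambda>(x, y). SCons (num x) (num y)) ?pairs)) ?tv2"
    by (rule ev_mono) (simp_all add: length_prog)
  moreover have "(\<lambda>(x, y). SCons (num x) (num y)) = encode_pair" by auto
  ultimately have v2: "ev prog ?env ?v2 (encode_list (map encode_pair ?pairs)) ?tv2" by simp
  have "evs prog ?env [?v2, ?v2]
      [encode_list (map encode_pair ?pairs), encode_list (map encode_pair ?pairs)] (?tv2 + (?tv2 + 0))"
    by (intro evs_Cons evs_Nil v2)
  from ev_Call[OF this _ product_ev]
  have "ev prog ?env (Call PRODUCT [?v2, ?v2])
      (encode_list (map (\<lambda>(x, y). SCons (encode_pair x) (encode_pair y)) (List.product ?pairs ?pairs)))
      (2 * ?tv2 + (15 * (n * n) + 50) * Suc (n * n) + 1)"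
    by (rule ev_mono) (simp_all add: length_prog)
  moreover have "(\<lambda>(x, y). SCons (encode_pair x) (encode_pair y)) = encode_fact" by auto
  ultimately have facts: "ev prog ?env (Call PRODUCT [?v2, ?v2]) (encode_table (all_facts n))
      (2 * ?tv2 + (15 * (n * n) + 50) * Suc (n * n) + 1)"
    by (simp add: encode_table_def all_facts_def)
  have "evs prog ?env
     [Hd (Var 0), Hd (Tl (Var 0)), Hd (Tl (Tl (Var 0))), ?v, Call PRODUCT [?v2, ?v2]]
     [encode_graph G, encode_set n I, encode_set n J, encode_vertices n, encode_table (all_facts n)]
     (2 + (3 + (4 + (?tv + 3 + (2 * ?tv2 + (15 * (n * n) + 50) * Suc (n * n) + 1 + 0)))))"
    by (intro evs_Cons evs_Nil v facts ev_mono[OF ev_atomic]) simp_all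
  from ev_Call[OF this _ decide_ev] show ?thesis
    unfolding prog_nth main_body_def Let_def t_main_def
    by (rule ev_mono) (simp_all add: length_prog)
qed

end

section \<open>Polynomial bounds\<close>

definition poly_bounded :: "(nat \<Rightarrow> nat) \<Rightarrow> bool" where
  "poly_bounded f \<longleftrightarrow> (\<exists>p :: nat poly. \<forall>n. f n \<le> poly p n)"

lemma poly_bounded_const: "poly_bounded (\<lambda>n. c)"
  unfolding poly_bounded_def by (rule exI[of _ "[:c:]"]) simp

lemma poly_bounded_id: "poly_bounded (\<lambda>n. n)"
  unfolding poly_bounded_def by (rule exI[of _ "[:0, 1:]"]) simp

lemma poly_bounded_add: "poly_bounded f \<Longrightarrow> poly_bounded g \<Longrightarrow> poly_bounded (\<lambda>n. f n + g n)"
  unfolding poly_bounded_def by (metis add_le_mono poly_add)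

lemma poly_bounded_mult: "poly_bounded f \<Longrightarrow> poly_bounded g \<Longrightarrow> poly_bounded (\<lambda>n. f n * g n)"
  unfolding poly_bounded_def by (metis mult_le_mono poly_mult)

lemma poly_bounded_Suc: "poly_bounded f \<Longrightarrow> poly_bounded (\<lambda>n. Suc (f n))"
  using poly_bounded_add[of f "\<lambda>_. 1"] poly_bounded_const[of 1] by simp

lemma poly_bounded_power: "poly_bounded f \<Longrightarrow> poly_bounded (\<lambda>n. f n ^ k)"
  by (induction k) (simp_all add: poly_bounded_const poly_bounded_mult)

lemma poly_bounded_t_main: "poly_bounded t_main"
  unfolding t_main_def t_match_def t_ex_token_def t_same_def t_iterate_def t_derive_def
    t_derivable_def t_ex_pred_def t_all_tokens_def t_ex_pos_def t_member_def
  by (intro poly_bounded_add poly_bounded_mult poly_bounded_Suc poly_bounded_power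
      poly_bounded_id poly_bounded_const)

text \<open>Coefficients in \<open>nat\<close> make the polynomial monotone. This turns a bound in
  the number of vertices into one in the input size.\<close>

lemma poly_nat_mono: "m \<le> n \<Longrightarrow> poly p m \<le> poly p n" for p :: "nat poly"
  by (induction p) (simp_all add: add_le_mono mult_le_mono)

lemma size_encode_list_ge: "length xs \<le> size (encode_list xs)"
  by (induction xs) simp_all

text \<open>All position sets lie in \<open>{..<n}\<close>, so the loops over the vertices decide
  their equality.\<close>

lemma (in encoded_graph) accepts_iff:
  assumes "interval_graph G" and I: "I \<in> independent_sets G k" and J: "J \<in> independent_sets G k"
  shows "accepts I J \<longleftrightarrow> same_component (TS k G) I J"
proof -
  let ?K = "\<lambda>A i. {u. ((i, u), (i, i)) \<in> pair_closure adj (pverts G) A}"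
  obtain prec where "interval_ordered_graph G prec"
    using interval_graph_order[OF assms(1)] by blast
  then interpret interval_ordered_graph G prec .
  have "pair_graph G" using assms(1) by (simp add: interval_graph_def)
  note iff = same_component_iff_positions[OF this I J]
  have sub: "I \<subseteq> {..<n}" "J \<subseteq> {..<n}" using I J by (auto simp: independent_sets_def pverts_G)
  have "?K A i \<subseteq> {..<n}" for A i
    using table_closure_list[of A] set_closure_list[of A] by (auto simp: table_def pverts_G)
  then have "?K I i = ?K J j \<longleftrightarrow> (\<forall>x\<in>{..<n}. ((i, x), (i, i)) \<in> set (closure_list I) \<longleftrightarrow>
       ((j, x), (j, j)) \<in> set (closure_list J))" for i j
    unfolding set_closure_list pverts_G by blast
  then show ?thesis unfolding iff using sub by blast
qed

theorem theorem3:
  shows "\<exists>P :: program.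
    decides_in_poly_time P encode_instance
      {(G, k, I, J). interval_graph G \<and> (\<exists>n. pverts G = {..<n}) \<and>
         I \<in> independent_sets G k \<and> J \<in> independent_sets G k}
      (\<lambda>(G, k, I, J). same_component (TS k G) I J)"
proof -
  have "poly_bounded (\<lambda>m. t_main m + 2)"
    by (intro poly_bounded_add poly_bounded_t_main poly_bounded_const)
  then obtain p :: "nat poly" where p: "\<And>m. t_main m + 2 \<le> poly p m"
    unfolding poly_bounded_def by blast
  have "decides_in_poly_time prog encode_instance
      {(G, k, I, J). interval_graph G \<and> (\<exists>n. pverts G = {..<n}) \<and>
         I \<in> independent_sets G k \<and> J \<in> independent_sets G k}
      (\<lambda>(G, k, I, J). same_component (TS k G) I J)"
    unfolding decides_in_poly_time_def
  proof (intro exI[of _ p] ballI, clarify)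
    fix G :: "nat pair_pre_digraph" and k n :: nat and I J :: "nat set"
    assume G: "interval_graph G" "pverts G = {..<n}"
      and IJ: "I \<in> independent_sets G k" "J \<in> independent_sets G k"
    interpret encoded_graph G n by unfold_locales fact
    let ?x = "encode_instance (G, k, I, J)"
    \<comment> \<open>The matrix is a list of \<open>n\<close> rows.\<close>
    have "n \<le> size (encode_graph G)"
      using size_encode_list_ge[of "map (\<lambda>u. encode_set n {v. adj u v}) [0..<n]"]
      by (simp add: encode_graph_def G(2))
    then have n: "n \<le> size ?x" by simp
    \<comment> \<open>The 2 extra steps are the argument \<open>Var 0\<close> and the call
      itself.\<close>
    have "ev prog [?x] (Call 0 [Var 0]) (encode_bool (accepts I J)) (t_main n + 2)"
      by (rule ev_mono[OF ev_call_atomic[OF main_ev[of I J]]]) (simp_all add: length_prog G(2))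
    then obtain t where "t \<le> t_main n + 2" "runs prog ?x (encode_bool (accepts I J)) t"
      unfolding ev_def runs_def by blast
    moreover have "t_main n + 2 \<le> poly p (size ?x)"
      using p[of n] poly_nat_mono[OF n] by (rule order_trans)
    ultimately show "\<exists>v t. runs prog ?x v t \<and> t \<le> poly p (size ?x) \<and>
        (v \<noteq> SNil \<longleftrightarrow> same_component (TS k G) I J)"
      unfolding accepts_iff[OF G(1) IJ] by (meson encode_bool_eq_SNil order_trans)
  qed
  then show ?thesis by blast
qed

end
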